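(* Let $\Gamma$ be a group generated by a finite symmetric set $\Sigma$ for which $\mathrm{Cay}(\Gamma,\Sigma)$ is not bipartite. Let $(N_j)_{j\ge 2}$ be a family of normal finite index subgroups of $\Gamma$. Let $Z\subseteq\Gamma$ and assume that: 1. $\Gamma$ has property-$\tau$ with respect to the family $\{N_i\cap N_j \mid i,j\ge 2\}$. 2. The sequence $(|\Gamma/N_j|)_{j\ge 2}$ grows polynomially in $j$. 3. $|\Gamma/(N_i\cap N_j)|=|\Gamma/N_i|\,|\Gamma/N_j|$ for distinct $i$ and $j$. 4. There exists $c>0$ such that $|ZN_j/N_j|\le(1-c)|\Gamma/N_j|$ for every $j\ge 2$. Then there are positive constants $\gamma$ and $r$, depending only on $\Sigma$, $c$ and the growth of $(|\Gamma/N_j|)_{j\ge 2}$, such that $\mathrm{Prob}_\Sigma(w_k\in Z)\le e^{-\gamma k}$ for every $k\ge r$. In particular, $Z$ is exponentially small.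
   Context: A finite multi-subset $\Sigma=[s_1,\dots,s_{|\Sigma|}]$ of a group $\Gamma$ is symmetric if each $s$ occurs in it as often as $s^{-1}$; it is admissible if it is symmetric and the Cayley graph $\mathrm{Cay}(\Gamma,\Sigma)$ (loops and multiple edges allowed) is not bipartite. For $Z\subseteq\Gamma$, $\mathrm{Prob}_\Sigma(w_k\in Z)=|\Sigma|^{-k}\,|\{(i_1,\dots,i_k): s_{i_1}\cdots s_{i_k}\in Z\}|$ is the probability that the $k$-th step $w_k$ of the simple random walk on $\mathrm{Cay}(\Gamma,\Sigma)$ started at the identity lies in $Z$. A subset $Z\subseteq\Gamma$ is exponentially small with respect to $\Sigma$ if there are constants $c',\alpha>0$ with $\mathrm{Prob}_\Sigma(w_k\in Z)\le c'e^{-\alpha k}$ for all $k\in\mathbb{N}$; it is exponentially small if this holds for every admissible generating multi-subset of $\Gamma$. That $(|\Gamma/N_j|)_{j\ge2}$ grows polynomially in $j$ means that there is a constant $d$ with $|\Gamma/N_j|\le j^d$ for all $j\ge 2$. The spectral gap of a finite $D$-regular graph is $1-\lambda_2$, where $1=\lambda_1\ge\lambda_2\ge\dots$ are the eigenvalues of the normalized adjacency matrix (adjacency matrix divided by $D$). A family of graphs is an $\varepsilon$-expander if each has spectral gap at least $\varepsilon$. A finitely generated group $\Gamma$ has property-$\tau$ with respect to a family $\mathcal{N}$ of finite index normal subgroups if for some (equivalently, every) finite symmetric generating multi-set $\Sigma$ there is $\varepsilon>0$ such that $\{\mathrm{Cay}(\Gamma/N,\Sigma_N)\mid N\in\mathcal{N}\}$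 is an $\varepsilon$-expander, where $\Sigma_N$ is the image multi-set of $\Sigma$ in $\Gamma/N$.
   Formalization: The constants γ and r are allowed to depend also on the expansion constant ε of Σ for the family {N_i∩N_j}; with dependence only on Σ, c and the growth, uniformly over all families, the claim is false. *)

theory Defs
  imports
    Complex_Main
    "HOL-Library.Multiset"
    "HOL-Algebra.Generated_Groups"
    "HOL-Algebra.Coset"
    "Jordan_Normal_Form.Char_Poly"
begin

(* A graph with loops and multiple edges is given by its vertex set V and a function m,
   where m x y is the number of edges from x to y. *)

definition bipartite :: "'v set \<Rightarrow> ('v \<Rightarrow> 'v \<Rightarrow> nat) \<Rightarrow> bool" where
  "bipartite V m \<longleftrightarrow>
     (\<exists>A B. A \<union> B = V \<and> A \<inter> B = {} \<and>
        (\<forall>x\<in>V. \<forall>y\<in>V. 0 < m x y \<longrightarrow> (x \<in> A \<and> y \<in> B) \<or> (x \<in> B \<and> y \<in> A)))"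

definition normalized_adj_mat ::
    "'v list \<Rightarrow> ('v \<Rightarrow> 'v \<Rightarrow> nat) \<Rightarrow> nat \<Rightarrow> real mat" where
  "normalized_adj_mat vs m D =
     mat (length vs) (length vs) (\<lambda>(i, j). real (m (vs ! i) (vs ! j)) / real D)"

(* For symmetric real matrices all complex eigenvalues are real, so that no eigenvalue is
   missing from this list; they are repeated according to multiplicity. *)
definition eigenvalues_decreasing :: "real mat \<Rightarrow> real list" where
  "eigenvalues_decreasing M = rev (sorted_list_of_multiset (proots (char_poly M)))"

(* The choice of the enumeration of V does not matter: another one conjugates the matrix
   by a permutation matrix.  Indexing starts at 0, so position 1 holds the second largest
   eigenvalue. *)
definition spectral_gap :: "'v set \<Rightarrow> ('v \<Rightarrow> 'v \<Rightarrow> nat) \<Rightarrow> nat \<Rightarrow> real" where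
  "spectral_gap V m D =
     1 - eigenvalues_decreasing
           (normalized_adj_mat (SOME vs. distinct vs \<and> set vs = V) m D) ! 1"

(* A graph with a single vertex has no second eigenvalue and imposes no condition. *)
definition expander :: "real \<Rightarrow> 'v set \<Rightarrow> ('v \<Rightarrow> 'v \<Rightarrow> nat) \<Rightarrow> nat \<Rightarrow> bool" where
  "expander \<epsilon> V m D \<longleftrightarrow> finite V \<and> (2 \<le> card V \<longrightarrow> \<epsilon> \<le> spectral_gap V m D)"

(* Edges of the Cayley graph with vertex set carrier G: one edge from x to x s for every
   occurrence of s in S. *)
definition cayley_edges ::
    "('a, 'b) monoid_scheme \<Rightarrow> 'a multiset \<Rightarrow> 'a \<Rightarrow> 'a \<Rightarrow> nat" where
  "cayley_edges G S x y = size (filter_mset (\<lambda>s. x \<otimes>\<^bsub>G\<^esub> s = y) S)"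

definition symmetric_in :: "('a, 'b) monoid_scheme \<Rightarrow> 'a multiset \<Rightarrow> bool" where
  "symmetric_in G S \<longleftrightarrow>
     set_mset S \<subseteq> carrier G \<and> (\<forall>s\<in>carrier G. count S s = count S (inv\<^bsub>G\<^esub> s))"

definition admissible :: "('a, 'b) monoid_scheme \<Rightarrow> 'a multiset \<Rightarrow> bool" where
  "admissible G S \<longleftrightarrow> symmetric_in G S \<and> \<not> bipartite (carrier G) (cayley_edges G S)"

definition generates :: "('a, 'b) monoid_scheme \<Rightarrow> 'a multiset \<Rightarrow> bool" where
  "generates G S \<longleftrightarrow> generate G (set_mset S) = carrier G"

definition cayley_expander_family ::
    "('a, 'b) monoid_scheme \<Rightarrow> 'a multiset \<Rightarrow> 'a set set \<Rightarrow> real \<Rightarrow> bool" where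
  "cayley_expander_family G S \<N> \<epsilon> \<longleftrightarrow>
     (\<forall>N\<in>\<N>. expander \<epsilon> (carrier (G Mod N))
        (cayley_edges (G Mod N) (image_mset (\<lambda>s. N #>\<^bsub>G\<^esub> s) S)) (size S))"

definition property_tau :: "('a, 'b) monoid_scheme \<Rightarrow> 'a set set \<Rightarrow> bool" where
  "property_tau G \<N> \<longleftrightarrow>
     (\<exists>S. symmetric_in G S \<and> generates G S \<and> (\<exists>\<epsilon>>0. cayley_expander_family G S \<N> \<epsilon>))"

(* The multiset of all products s_{i_1} ... s_{i_k}, one occurrence for each of the
   (size S)^k index tuples (i_1, ..., i_k). *)
primrec walk_ends ::
    "('a, 'b) monoid_scheme \<Rightarrow> 'a multiset \<Rightarrow> nat \<Rightarrow> 'a multiset" where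
  "walk_ends G S 0 = {#\<one>\<^bsub>G\<^esub>#}"
| "walk_ends G S (Suc k) = (\<Sum>s\<in>#S. image_mset (\<lambda>w. w \<otimes>\<^bsub>G\<^esub> s) (walk_ends G S k))"

definition walk_prob ::
    "('a, 'b) monoid_scheme \<Rightarrow> 'a multiset \<Rightarrow> nat \<Rightarrow> 'a set \<Rightarrow> real" where
  "walk_prob G S k Z =
     real (size (filter_mset (\<lambda>w. w \<in> Z) (walk_ends G S k))) / real (size S) ^ k"

definition exponentially_small_wrt ::
    "('a, 'b) monoid_scheme \<Rightarrow> 'a multiset \<Rightarrow> 'a set \<Rightarrow> bool" where
  "exponentially_small_wrt G S Z \<longleftrightarrow>
     (\<exists>c'>0. \<exists>\<alpha>>0. \<forall>k. walk_prob G S k Z \<le> c' * exp (- \<alpha> * real k))"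

definition exponentially_small :: "('a, 'b) monoid_scheme \<Rightarrow> 'a set \<Rightarrow> bool" where
  "exponentially_small G Z \<longleftrightarrow>
     (\<forall>S. admissible G S \<and> generates G S \<longrightarrow> exponentially_small_wrt G S Z)"

end

theory Submission
  imports Defs "HOL-Analysis.L2_Norm" "HOL-Analysis.Function_Topology"
begin

text \<open>
  On a finite quotient, the second largest eigenvalue of the walk bounds its quadratic form on the
  mean-zero functions from above. A closed walk of odd length in the group bounds the form from
  below, uniformly over all quotients. Hence the walk contracts mean-zero functions by a factor
  \<open>\<rho> < 1\<close> and equidistributes exponentially fast in every \<open>G Mod (N i \<inter> N j)\<close>. By the index condition the
  events \<open>w\<^sub>k N\<^sub>j \<in> Z N\<^sub>j\<close>, for \<open>j\<close> in a set \<open>J\<close> of \<open>L\<close> indices, are nearly pairwise independent, and each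
  has probability at most about \<open>1 - c\<close>. On \<open>w\<^sub>k \<in> Z\<close> all of them occur, so Chebyshev's inequality
  gives a bound of order \<open>1/L + L\<^bsup>2d\<^esup> \<rho>\<^sup>k\<close>, and \<open>L\<close> is taken exponential in \<open>k\<close>.
  Dirichlet forms of two generating multisets are comparable on all quotients at once, which makes
  property tau independent of the multiset.
\<close>

subsection \<open>Symmetric stochastic kernels\<close>

text \<open>The spectral gap is defined through the second entry of a sorted list of roots of a
  characteristic polynomial, whereas the walk needs an inequality between quadratic forms. Since
  roots are counted with multiplicity, one copy of the eigenvalue 1 is split off algebraically. The
  remaining roots are the eigenvalues on mean-zero functions, and their maximum is found by
  maximizing the form on a compact sphere instead of diagonalizing. The gap says nothing about
  eigenvalues near -1, and a lower bound obtained in each quotient separately could degenerate along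
  the family. The odd closed walk is therefore chosen once in the group: its image has the same
  length in every quotient. The family of intersections plays two roles: \<open>i = j\<close> gives
  the subgroups \<open>N j\<close> themselves and so the means, distinct indices give the
  correlations. A quotient of the second kind has order up to the square of the polynomial bound,
  whence the exponent 2d.\<close>

lemma compact_bounded_functions:
  "compact {g :: 'v \<Rightarrow> real. (\<forall>x. x \<notin> V \<longrightarrow> g x = 0) \<and> (\<forall>x\<in>V. \<bar>g x\<bar> \<le> 1)}" (is "compact ?K")
proof -
  \<comment> \<open>The prescribed value 0 off \<open>V\<close> makes this a product of compact
    factors over the whole type, so Tychonoff applies.\<close>
  have eq: "?K = PiE UNIV (\<lambda>x. if x \<in> V then {-1..1} else {0})"
    by (fastforce simp: PiE_iff abs_le_iff split: if_splits)
  have "compactin (product_topology (\<lambda>_. euclideanreal) UNIV) ?K"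
    unfolding eq compactin_PiE by auto
  then show ?thesis
    by (simp add: euclidean_product_topology)
qed

definition bilin :: "'v set \<Rightarrow> ('v \<Rightarrow> 'v \<Rightarrow> real) \<Rightarrow> ('v \<Rightarrow> real) \<Rightarrow> ('v \<Rightarrow> real) \<Rightarrow> real" where
  "bilin V a g h = (\<Sum>x\<in>V. (\<Sum>y\<in>V. a x y * g y) * h x)"

lemma bilin_add_left: "bilin V a (\<lambda>x. g x + t * g' x) h = bilin V a g h + t * bilin V a g' h"
  by (simp add: bilin_def algebra_simps sum.distrib sum_distrib_left sum_distrib_right)

lemma bilin_add_right: "bilin V a g (\<lambda>x. h x + t * h' x) = bilin V a g h + t * bilin V a g h'"
  by (simp add: bilin_def algebra_simps sum.distrib sum_distrib_left sum_distrib_right)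

lemma bilin_commute:
  assumes "\<And>x y. x \<in> V \<Longrightarrow> y \<in> V \<Longrightarrow> a x y = a y x"
  shows "bilin V a g h = bilin V a h g"
proof -
  have "bilin V a g h = (\<Sum>x\<in>V. \<Sum>y\<in>V. a x y * g y * h x)"
    by (simp add: bilin_def sum_distrib_right)
  also have "\<dots> = (\<Sum>y\<in>V. \<Sum>x\<in>V. a x y * g y * h x)"
    by (rule sum.swap)
  also have "\<dots> = (\<Sum>y\<in>V. \<Sum>x\<in>V. a y x * h x * g y)"
    by (intro sum.cong refl) (simp add: assms mult_ac)
  finally show ?thesis
    by (simp add: bilin_def sum_distrib_right)
qed

lemma bilin_mult_left: "bilin V a (\<lambda>x. t * g x) h = t * bilin V a g h"
  by (simp add: bilin_def algebra_simps sum_distrib_left sum_distrib_right)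

lemma bilin_mult_right: "bilin V a g (\<lambda>x. t * h x) = t * bilin V a g h"
  by (simp add: bilin_def algebra_simps sum_distrib_left sum_distrib_right)

lemma bilin_cong:
  "(\<And>x. x \<in> V \<Longrightarrow> g x = g' x) \<Longrightarrow> (\<And>x. x \<in> V \<Longrightarrow> h x = h' x) \<Longrightarrow> bilin V a g h = bilin V a g' h'"
  by (simp add: bilin_def)

text \<open>Divide by \<open>t\<close> and let \<open>t\<close> tend to 0. This turns maximality
  along a line into a statement about the first-order term.\<close>

lemma linear_le_quadratic:
  fixes A B :: real
  assumes "\<And>t. 0 < t \<Longrightarrow> 2 * t * A \<le> t\<^sup>2 * B"
  shows "A \<le> 0"
proof (rule ccontr)
  assume "\<not> A \<le> 0"
  then have A: "A > 0" by simp
  \<comment> \<open>Small enough that \<open>t * B\<close> is at most \<open>A\<close>,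
    contradicting 2A \<le> t B; the 1 keeps the denominator positive.\<close>
  define t where "t = A / (\<bar>B\<bar> + 1)"
  have t: "t > 0" using A by (simp add: t_def)
  have "2 * A \<le> t * B" using assms[OF t] t by (simp add: power2_eq_square)
  also have "\<dots> \<le> t * (\<bar>B\<bar> + 1)" using t by (intro mult_left_mono) auto
  also have "\<dots> = A" by (simp add: t_def)
  finally show False using A by simp
qed

text \<open>A maximizer of the form on the mean-zero unit sphere is an eigenvector, because its
  residual is itself a mean-zero direction in which the form can be varied.\<close>

lemma exists_top_eigenvector:
  fixes a :: "'v \<Rightarrow> 'v \<Rightarrow> real"
  assumes fin: "finite V" and card: "2 \<le> card V"
    and sym: "\<And>x y. x \<in> V \<Longrightarrow> y \<in> V \<Longrightarrow> a x y = a y x"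
    and rows: "\<And>x. x \<in> V \<Longrightarrow> (\<Sum>y\<in>V. a x y) = 1"
  shows "\<exists>\<mu> u. (\<Sum>x\<in>V. u x) = 0 \<and> (\<exists>x\<in>V. u x \<noteq> 0) \<and>
    (\<forall>x\<in>V. (\<Sum>y\<in>V. a x y * u y) = \<mu> * u x) \<and>
    (\<forall>g. (\<Sum>x\<in>V. g x) = 0 \<longrightarrow> bilin V a g g \<le> \<mu> * (\<Sum>x\<in>V. (g x)\<^sup>2))"
proof -
  let ?K = "{g :: 'v \<Rightarrow> real. (\<forall>x. x \<notin> V \<longrightarrow> g x = 0) \<and> (\<forall>x\<in>V. \<bar>g x\<bar> \<le> 1)}"
  let ?C = "{g :: 'v \<Rightarrow> real. (\<Sum>x\<in>V. (g x)\<^sup>2) = 1} \<inter> {g. (\<Sum>x\<in>V. g x) = 0}"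
  have coord: "continuous_on UNIV (\<lambda>g :: 'v \<Rightarrow> real. g x)" for x
    by simp
  have "closed ?C"
    by (intro closed_Int closed_Collect_eq continuous_intros coord)
  then have comp: "compact (?K \<inter> ?C)"
    using compact_bounded_functions by (intro compact_Int_closed)
  have cont: "continuous_on (?K \<inter> ?C) (\<lambda>g. bilin V a g g)"
    unfolding bilin_def
    by (rule continuous_on_subset[of UNIV]) (intro continuous_intros coord, simp)
  have normalise: "(\<lambda>x. if x \<in> V then g x / sqrt (\<Sum>x\<in>V. (g x)\<^sup>2) else 0) \<in> ?K \<inter> ?C"
    if g0: "(\<Sum>x\<in>V. g x) = 0" and gn: "\<exists>x\<in>V. g x \<noteq> 0" for g :: "'v \<Rightarrow> real"
  proof -
    let ?s = "\<Sum>x\<in>V. (g x)\<^sup>2"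
    have pos: "?s > 0"
      using gn fin by (meson sum_pos2 zero_less_power2 zero_le_power2)
    have le: "\<bar>g x\<bar> / sqrt ?s \<le> 1" if "x \<in> V" for x
    proof -
      have "(g x)\<^sup>2 \<le> ?s" using that fin by (intro member_le_sum) auto
      then have "\<bar>g x\<bar> \<le> sqrt ?s" by (metis real_sqrt_abs real_sqrt_le_iff)
      then show ?thesis using pos by simp
    qed
    have "(\<Sum>x\<in>V. (g x / sqrt ?s)\<^sup>2) = 1"
      using pos by (simp add: power_divide flip: sum_divide_distrib)
    moreover have "(\<Sum>x\<in>V. g x / sqrt ?s) = 0"
      using g0 by (simp flip: sum_divide_distrib)
    ultimately show ?thesis
      using le pos by (auto simp: sum_nonneg)
  qed
  obtain p q where pq: "p \<in> V" "q \<in> V" "p \<noteq> q"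
    by (metis card fin card_le_Suc0_iff_eq not_less_eq_eq numeral_2_eq_2)
  \<comment> \<open>A difference of two point masses is mean-zero and nonzero, so the sphere is not
    empty.\<close>
  define e where "e = (\<lambda>x. (if x = p then 1 else 0) - (if x = q then 1 else 0 :: real))"
  have "(\<Sum>x\<in>V. e x) = 0"
    using pq fin by (simp add: e_def sum_subtractf)
  moreover have "e p \<noteq> 0" using pq by (simp add: e_def)
  ultimately have "?K \<inter> ?C \<noteq> {}"
    using normalise[of e] pq(1) by (metis (no_types, lifting) empty_iff)
  then obtain u where u: "u \<in> ?K \<inter> ?C"
    and umax: "\<And>g. g \<in> ?K \<inter> ?C \<Longrightarrow> bilin V a g g \<le> bilin V a u u"
    using continuous_attains_sup[OF comp _ cont] by blast
  define \<mu> where "\<mu> = bilin V a u u"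
  have u0: "(\<Sum>x\<in>V. u x) = 0" and u1: "(\<Sum>x\<in>V. (u x)\<^sup>2) = 1" using u by auto
  have bound: "bilin V a g g \<le> \<mu> * (\<Sum>x\<in>V. (g x)\<^sup>2)" if g0: "(\<Sum>x\<in>V. g x) = 0" for g
  proof (cases "\<exists>x\<in>V. g x \<noteq> 0")
    case False
    then show ?thesis by (auto simp: bilin_def)
  next
    case True
    let ?s = "\<Sum>x\<in>V. (g x)\<^sup>2"
    have pos: "?s > 0"
      using True fin by (meson sum_pos2 zero_less_power2 zero_le_power2)
    have "bilin V a g g / ?s = bilin V a (\<lambda>x. 1 / sqrt ?s * g x) (\<lambda>x. 1 / sqrt ?s * g x)"
      using pos by (simp only: bilin_mult_left bilin_mult_right) (simp add: field_simps)
    also have "\<dots> = bilin V a (\<lambda>x. if x \<in> V then g x / sqrt ?s else 0)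
        (\<lambda>x. if x \<in> V then g x / sqrt ?s else 0)"
      by (intro bilin_cong) auto
    also have "\<dots> \<le> \<mu>" unfolding \<mu>_def by (rule umax[OF normalise[OF g0 True]])
    finally show ?thesis using pos by (simp add: divide_le_eq)
  qed
  \<comment> \<open>The residual of the eigenvalue equation. Symmetry and the row sums make it
    mean-zero, so \<open>bound\<close> applies to u + t r; by \<open>rr\<close> the first-order term
    in \<open>t\<close> is twice the squared norm of \<open>r\<close>, which must then
    vanish.\<close>
  define r where "r = (\<lambda>x. (\<Sum>y\<in>V. a x y * u y) - \<mu> * u x)"
  have "(\<Sum>x\<in>V. \<Sum>y\<in>V. a x y * u y) = bilin V a u (\<lambda>_. 1)"
    by (simp add: bilin_def)
  also have "\<dots> = bilin V a (\<lambda>_. 1) u" by (rule bilin_commute[OF sym])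
  also have "\<dots> = 0" using rows u0 by (simp add: bilin_def)
  finally have r0: "(\<Sum>x\<in>V. r x) = 0"
    using u0 by (simp add: r_def sum_subtractf flip: sum_distrib_left)
  have rr: "bilin V a u r - \<mu> * (\<Sum>x\<in>V. u x * r x) = (\<Sum>x\<in>V. (r x)\<^sup>2)"
    by (simp add: bilin_def r_def sum_distrib_left power2_eq_square algebra_simps flip: sum_subtractf)
  have "(\<Sum>x\<in>V. (r x)\<^sup>2) \<le> 0"
  proof (rule linear_le_quadratic)
    fix t :: real assume "0 < t"
    let ?g = "\<lambda>x. u x + t * r x"
    have "(\<Sum>x\<in>V. ?g x) = 0"
      using u0 r0 by (simp add: sum.distrib flip: sum_distrib_left)
    then have "bilin V a ?g ?g \<le> \<mu> * (\<Sum>x\<in>V. (?g x)\<^sup>2)" by (rule bound)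
    moreover have "bilin V a ?g ?g = \<mu> + 2 * t * bilin V a u r + t\<^sup>2 * bilin V a r r"
      using bilin_commute[OF sym, where g = u and h = r]
      by (simp add: bilin_add_left bilin_add_right \<mu>_def power2_eq_square algebra_simps)
    moreover have "(\<Sum>x\<in>V. (?g x)\<^sup>2) =
        1 + 2 * t * (\<Sum>x\<in>V. u x * r x) + t\<^sup>2 * (\<Sum>x\<in>V. (r x)\<^sup>2)"
      by (simp add: power2_sum sum.distrib u1 sum_distrib_left power_mult_distrib algebra_simps)
    ultimately show "2 * t * (\<Sum>x\<in>V. (r x)\<^sup>2) \<le>
        t\<^sup>2 * (\<mu> * (\<Sum>x\<in>V. (r x)\<^sup>2) - bilin V a r r)"
      unfolding rr[symmetric] by (simp add: algebra_simps)
  qed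
  then have "(\<Sum>x\<in>V. (r x)\<^sup>2) = 0"
    by (simp add: antisym sum_nonneg)
  then have "r x = 0" if "x \<in> V" for x
    using fin that by (simp add: sum_nonneg_eq_0_iff)
  then have ev: "(\<Sum>y\<in>V. a x y * u y) = \<mu> * u x" if "x \<in> V" for x
    using that by (simp add: r_def)
  have "\<exists>x\<in>V. u x \<noteq> 0"
    using u1 by (metis (mono_tags, lifting) sum.neutral zero_neq_one zero_power2)
  then show ?thesis using u0 ev bound by blast
qed

text \<open>Conjugation to the basis \<open>(1,\<dots>,1), e\<^sub>1, \<dots>, e\<^sub>m\<close> splits off the eigenvalue 1.\<close>

lemma char_poly_stochastic:
  fixes a :: "nat \<Rightarrow> nat \<Rightarrow> 'a :: comm_ring_1"
  assumes rows: "\<And>i. i < Suc m \<Longrightarrow> (\<Sum>j<Suc m. a i j) = 1"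
  shows "char_poly (mat (Suc m) (Suc m) (\<lambda>(i, j). a i j)) =
    [:-1, 1:] * char_poly (mat m m (\<lambda>(i, j). a (Suc i) (Suc j) - a 0 (Suc j)))"
proof -
  let ?n = "Suc m"
  let ?A = "mat ?n ?n (\<lambda>(i, j). a i j)"
  define P :: "'a mat" where "P = mat ?n ?n (\<lambda>(i, j). if j = 0 \<or> i = j then 1 else 0)"
  define Q :: "'a mat" where "Q = mat ?n ?n (\<lambda>(i, j). if i = j then 1 else if j = 0 then -1 else 0)"
  define A1 :: "'a mat" where "A1 = mat 1 1 (\<lambda>_. 1)"
  define A2 where "A2 = mat 1 m (\<lambda>(i, j). a 0 (Suc j))"
  define A3 where "A3 = mat m m (\<lambda>(i, j). a (Suc i) (Suc j) - a 0 (Suc j))"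
  \<comment> \<open>The kernel in the new basis. The row sums say that the all-ones vector is fixed,
    which gives the zero block; column j of the kernel is \<open>a 0 j\<close> times the all-ones
    vector plus the differences \<open>a i j - a 0 j\<close>.\<close>
  define B where "B = four_block_mat A1 A2 (0\<^sub>m m 1) A3"
  have B: "B = mat ?n ?n (\<lambda>(i, j). if i = 0 then if j = 0 then 1 else a 0 j
      else if j = 0 then 0 else a i j - a 0 j)"
    by (rule eq_matI) (auto simp: B_def A1_def A2_def A3_def)
  have Prow: "(\<Sum>k = 0..<?n. P $$ (i, k) * f k) = (if i = 0 then f 0 else f 0 + f i)"
    if "i < ?n" for i and f :: "nat \<Rightarrow> 'a"
  proof -
    have "(\<Sum>k = 0..<?n. P $$ (i, k) * f k) =
        (\<Sum>k = 0..<?n. (if k = 0 then f 0 else 0) + (if k = i then if i = 0 then 0 else f i else 0))"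
      using that by (intro sum.cong) (auto simp: P_def)
    also have "\<dots> = (if i = 0 then f 0 else f 0 + f i)"
      using that by (simp add: sum.distrib del: sum.op_ivl_Suc)
    finally show ?thesis .
  qed
  have Qrow: "(\<Sum>k = 0..<?n. Q $$ (i, k) * f k) = (if i = 0 then f 0 else f i - f 0)"
    if "i < ?n" for i and f :: "nat \<Rightarrow> 'a"
  proof -
    have "(\<Sum>k = 0..<?n. Q $$ (i, k) * f k) =
        (\<Sum>k = 0..<?n. (if k = i then f i else 0) - (if k = 0 then if i = 0 then 0 else f 0 else 0))"
      using that by (intro sum.cong) (auto simp: Q_def)
    also have "\<dots> = (if i = 0 then f 0 else f i - f 0)"
      using that by (simp add: sum_subtractf del: sum.op_ivl_Suc)
    finally show ?thesis .
  qed
  have Pcol: "(\<Sum>k = 0..<?n. f k * P $$ (k, j)) = (if j = 0 then \<Sum>k = 0..<?n. f k else f j)"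
    if "j < ?n" for j and f :: "nat \<Rightarrow> 'a"
  proof -
    have "(\<Sum>k = 0..<?n. f k * P $$ (k, j)) =
        (\<Sum>k = 0..<?n. if j = 0 then f k else if k = j then f j else 0)"
      using that by (intro sum.cong) (auto simp: P_def)
    then show ?thesis using that by (simp del: sum.op_ivl_Suc)
  qed
  have PQ: "P * Q = 1\<^sub>m ?n"
  proof (rule eq_matI)
    fix i j assume "i < dim_row (1\<^sub>m ?n :: 'a mat)" "j < dim_col (1\<^sub>m ?n :: 'a mat)"
    then show "(P * Q) $$ (i, j) = 1\<^sub>m ?n $$ (i, j)"
      using Prow[of i "\<lambda>k. Q $$ (k, j)"]
      by (auto simp: times_mat_def scalar_prod_def P_def Q_def simp del: sum.op_ivl_Suc)
  qed (auto simp: P_def Q_def)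
  have QP: "Q * P = 1\<^sub>m ?n"
  proof (rule eq_matI)
    fix i j assume "i < dim_row (1\<^sub>m ?n :: 'a mat)" "j < dim_col (1\<^sub>m ?n :: 'a mat)"
    then show "(Q * P) $$ (i, j) = 1\<^sub>m ?n $$ (i, j)"
      using Qrow[of i "\<lambda>k. P $$ (k, j)"]
      by (auto simp: times_mat_def scalar_prod_def P_def Q_def simp del: sum.op_ivl_Suc)
  qed (auto simp: P_def Q_def)
  have AP: "?A * P = P * B"
  proof (rule eq_matI)
    fix i j assume "i < dim_row (P * B)" "j < dim_col (P * B)"
    then have ij: "i < ?n" "j < ?n" by (auto simp: P_def B)
    have "(?A * P) $$ (i, j) = (\<Sum>k = 0..<?n. a i k * P $$ (k, j))"
      using ij by (auto simp: times_mat_def scalar_prod_def P_def simp del: sum.op_ivl_Suc)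
    also have "\<dots> = (if j = 0 then 1 else a i j)"
      unfolding Pcol[OF ij(2)] using rows[OF ij(1)] by (simp add: atLeast0LessThan del: sum.op_ivl_Suc sum.lessThan_Suc)
    also have "\<dots> = (\<Sum>k = 0..<?n. P $$ (i, k) * B $$ (k, j))"
      using ij by (simp add: Prow[OF ij(1)] B del: sum.op_ivl_Suc)
    also have "\<dots> = (P * B) $$ (i, j)"
      using ij by (auto simp: times_mat_def scalar_prod_def P_def B simp del: sum.op_ivl_Suc)
    finally show "(?A * P) $$ (i, j) = (P * B) $$ (i, j)" .
  qed (auto simp: P_def B)
  have carr: "?A \<in> carrier_mat ?n ?n" "B \<in> carrier_mat ?n ?n" "P \<in> carrier_mat ?n ?n" "Q \<in> carrier_mat ?n ?n"
    by (auto simp: P_def Q_def B)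
  have "?A = ?A * (P * Q)" using carr by (simp add: PQ)
  also have "\<dots> = ?A * P * Q"
    by (rule assoc_mult_mat[symmetric, OF carr(1) carr(3) carr(4)])
  also have "\<dots> = P * B * Q" by (simp only: AP)
  finally have "similar_mat ?A B"
    using carr PQ QP by (intro similar_matI[of _ _ P Q ?n]) auto
  then have "char_poly ?A = char_poly B" by (rule char_poly_similar)
  also have "\<dots> = char_poly A1 * char_poly A3"
    unfolding B_def by (rule char_poly_four_block_zeros_col) (auto simp: A1_def A2_def A3_def)
  also have "char_poly A1 = [:-1, 1:]"
    by (subst char_poly_upper_triangular[of _ 1]) (auto simp: A1_def diag_mat_def upper_triangular_def)
  finally show ?thesis by (simp add: A3_def)
qed

text \<open>The transpose of this matrix is the kernel acting on mean-zero functions in the coordinates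
  \<open>1, \<dots>, m\<close>; the coordinate 0 is determined by the others.\<close>

lemma poly_char_poly_stochastic_quotient:
  fixes a :: "nat \<Rightarrow> nat \<Rightarrow> real"
  assumes rows: "\<And>i. i < Suc m \<Longrightarrow> (\<Sum>j<Suc m. a i j) = 1"
    and sym: "\<And>i j. i < Suc m \<Longrightarrow> j < Suc m \<Longrightarrow> a i j = a j i"
  shows "poly (char_poly (mat m m (\<lambda>(i, j). a (Suc i) (Suc j) - a 0 (Suc j)))) \<theta> = 0 \<longleftrightarrow>
    (\<exists>f. (\<exists>i<Suc m. f i \<noteq> 0) \<and> (\<Sum>i<Suc m. f i) = 0 \<and>
      (\<forall>i<Suc m. (\<Sum>j<Suc m. a i j * f j) = \<theta> * f i))"
    (is "poly (char_poly ?M) \<theta> = 0 \<longleftrightarrow> ?R")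
proof -
  let ?T = "transpose_mat ?M"
  have T: "?T \<in> carrier_mat m m" by simp
  \<comment> \<open>Symmetry turns the column of the kernel into a row, and the mean-zero condition
    converts the subtracted row 0 into the missing term for coordinate 0.\<close>
  have action: "(\<Sum>i<m. (a (Suc i) (Suc j) - a 0 (Suc j)) * f (Suc i)) = (\<Sum>i<Suc m. a (Suc j) i * f i)"
    if "j < m" and f0: "(\<Sum>i<Suc m. f i) = 0" for j f
  proof -
    have "(\<Sum>i<m. (a (Suc i) (Suc j) - a 0 (Suc j)) * f (Suc i)) =
        (\<Sum>i<m. a (Suc i) (Suc j) * f (Suc i)) - a 0 (Suc j) * (\<Sum>i<m. f (Suc i))"
      by (simp add: algebra_simps sum_subtractf sum_distrib_left)
    also have "(\<Sum>i<m. f (Suc i)) = - f 0"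
      using f0 by (simp add: sum.lessThan_Suc_shift del: sum.lessThan_Suc)
    also have "(\<Sum>i<m. a (Suc i) (Suc j) * f (Suc i)) = (\<Sum>i<m. a (Suc j) (Suc i) * f (Suc i))"
      using that(1) by (intro sum.cong refl) (simp add: sym)
    also have "\<dots> - a 0 (Suc j) * - f 0 = (\<Sum>i<Suc m. a (Suc j) i * f i)"
      using that(1) by (simp add: sym[of 0] sum.lessThan_Suc_shift del: sum.lessThan_Suc)
    finally show ?thesis .
  qed
  have "poly (char_poly ?M) \<theta> = 0 \<longleftrightarrow> eigenvalue ?T \<theta>"
    unfolding eigenvalue_root_char_poly[OF T]
    by (subst char_poly_transpose_mat[of _ m]) auto
  also have "\<dots> \<longleftrightarrow> ?R"
  proof
    assume "eigenvalue ?T \<theta>"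
    then obtain v where v: "v \<in> carrier_vec m" "v \<noteq> 0\<^sub>v m" "?T *\<^sub>v v = \<theta> \<cdot>\<^sub>v v"
      by (auto simp: eigenvalue_def eigenvector_def)
    define f where "f i = (case i of 0 \<Rightarrow> - (\<Sum>i<m. v $ i) | Suc i \<Rightarrow> v $ i)" for i
    have f0: "(\<Sum>i<Suc m. f i) = 0"
      by (simp add: f_def sum.lessThan_Suc_shift del: sum.lessThan_Suc)
    have pos: "(\<Sum>i<Suc m. a (Suc j) i * f i) = \<theta> * f (Suc j)" if j: "j < m" for j
    proof -
      have "\<theta> * f (Suc j) = (?T *\<^sub>v v) $ j"
        using v(1) j by (simp add: f_def v(3) del: index_mult_mat_vec)
      also have "\<dots> = (\<Sum>i<m. (a (Suc i) (Suc j) - a 0 (Suc j)) * f (Suc i))"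
        using v(1) j by (simp add: scalar_prod_def f_def atLeast0LessThan mult_ac)
      finally show ?thesis by (simp only: action[OF j f0])
    qed
    \<comment> \<open>The matrix yields the eigenvalue equation only at the coordinates 1, ..., m.
      At coordinate 0 it follows because both sides sum to 0 over all coordinates.\<close>
    have "(\<Sum>i<Suc m. \<Sum>j<Suc m. a i j * f j) = (\<Sum>j<Suc m. \<Sum>i<Suc m. a i j * f j)"
      by (rule sum.swap)
    also have "\<dots> = (\<Sum>j<Suc m. (\<Sum>i<Suc m. a j i) * f j)"
      unfolding sum_distrib_right by (intro sum.cong refl) (simp add: sym)
    also have "\<dots> = (\<Sum>j<Suc m. f j)"
      by (intro sum.cong refl) (simp add: rows del: sum.lessThan_Suc)
    also have "\<dots> = 0" by (rule f0)
    finally have "(\<Sum>j<Suc m. a 0 j * f j) = - (\<Sum>i<m. \<theta> * f (Suc i))"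
      by (subst (asm) (1) sum.lessThan_Suc_shift) (simp add: pos del: sum.lessThan_Suc)
    also have "\<dots> = \<theta> * f 0"
      by (simp add: f_def flip: sum_distrib_left)
    finally have zero: "(\<Sum>j<Suc m. a 0 j * f j) = \<theta> * f 0" .
    have "(\<Sum>j<Suc m. a i j * f j) = \<theta> * f i" if "i < Suc m" for i
      using that zero pos by (cases i) (simp_all del: sum.lessThan_Suc)
    moreover have "\<exists>i<m. v $ i \<noteq> 0"
      using v(1,2) by (metis carrier_vecD eq_vecI index_zero_vec)
    then have "\<exists>i<Suc m. f i \<noteq> 0"
      by (metis Suc_mono f_def old.nat.simps(5))
    ultimately show ?R using f0 by blast
  next
    assume ?R
    then obtain f where nz: "\<exists>i<Suc m. f i \<noteq> 0" and f0: "(\<Sum>i<Suc m. f i) = 0"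
      and ev: "\<And>i. i < Suc m \<Longrightarrow> (\<Sum>j<Suc m. a i j * f j) = \<theta> * f i"
      by blast
    define v where "v = vec m (\<lambda>i. f (Suc i))"
    have "v \<noteq> 0\<^sub>v m"
    proof
      assume "v = 0\<^sub>v m"
      then have z: "f (Suc i) = 0" if "i < m" for i
        using that unfolding v_def by (metis index_vec index_zero_vec(1))
      then have "f 0 = 0"
        using f0 by (simp add: sum.lessThan_Suc_shift del: sum.lessThan_Suc)
      then show False using nz z less_Suc_eq_0_disj by auto
    qed
    moreover have "?T *\<^sub>v v = \<theta> \<cdot>\<^sub>v v"
    proof (rule eq_vecI)
      fix j assume "j < dim_vec (\<theta> \<cdot>\<^sub>v v)"
      then have j: "j < m" by (simp add: v_def)
      have "(?T *\<^sub>v v) $ j = (\<Sum>i<m. (a (Suc i) (Suc j) - a 0 (Suc j)) * f (Suc i))"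
        using j by (simp add: scalar_prod_def v_def atLeast0LessThan mult_ac)
      also have "\<dots> = \<theta> * f (Suc j)"
        unfolding action[OF j f0] using j by (intro ev) simp
      finally show "(?T *\<^sub>v v) $ j = (\<theta> \<cdot>\<^sub>v v) $ j" using j by (simp add: v_def)
    qed (simp add: v_def)
    ultimately show "eigenvalue ?T \<theta>"
      unfolding eigenvalue_def eigenvector_def by (intro exI[of _ v]) (simp add: v_def)
  qed
  finally show ?thesis .
qed

text \<open>Counting the entries above a threshold removes the sorted list from the argument.
  Repetitions count, so a second eigenvalue 1, as in a disconnected graph, is treated
  correctly.\<close>

lemma le_second_largest_iff:
  fixes t :: "'a :: linorder"
  assumes "2 \<le> size X"
  shows "t \<le> rev (sorted_list_of_multiset X) ! 1 \<longleftrightarrow> 2 \<le> size (filter_mset (\<lambda>x. t \<le> x) X)"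
proof -
  let ?L = "rev (sorted_list_of_multiset X)"
  have X: "mset ?L = X" by simp
  have "length ?L = size X" by (metis X size_mset)
  then obtain x y zs where L: "?L = x # y # zs"
    using assms by (metis Suc_le_length_iff numeral_2_eq_2)
  have "sorted_wrt (\<lambda>a b. b \<le> a) ?L"
    by (simp add: sorted_wrt_rev)
  then have ord: "y \<le> x" "\<And>z. z \<in> set zs \<Longrightarrow> z \<le> y"
    unfolding L by auto
  have X': "X = {#x, y#} + mset zs" using X unfolding L by simp
  show ?thesis
  proof
    assume "t \<le> ?L ! 1"
    then have "t \<le> y" unfolding L by simp
    moreover from this have "t \<le> x" using ord(1) by (rule order_trans)
    ultimately show "2 \<le> size (filter_mset (\<lambda>x. t \<le> x) X)" by (simp add: X')
  next
    assume 2: "2 \<le> size (filter_mset (\<lambda>x. t \<le> x) X)"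
    have "t \<le> y"
    proof (rule ccontr)
      assume n: "\<not> t \<le> y"
      then have none: "filter_mset (\<lambda>x. t \<le> x) (mset zs) = {#}"
        using ord(2) by (auto dest: order_trans)
      show False using 2 n unfolding X' filter_union_mset none by (simp split: if_splits)
    qed
    then show "t \<le> ?L ! 1" unfolding L by simp
  qed
qed

section \<open>The spectral gap of a regular graph as a bound on a quadratic form\<close>

locale regular_graph =
  fixes V :: "'v set" and m :: "'v \<Rightarrow> 'v \<Rightarrow> nat" and D :: nat
  assumes finite_vertices: "finite V" and two_vertices: "2 \<le> card V" and degree_pos: "0 < D"
    and edges_sym: "\<And>x y. x \<in> V \<Longrightarrow> y \<in> V \<Longrightarrow> m x y = m y x"
    and regular: "\<And>x. x \<in> V \<Longrightarrow> (\<Sum>y\<in>V. m x y) = D"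
begin

abbreviation adj :: "'v \<Rightarrow> 'v \<Rightarrow> real" where
  "adj x y \<equiv> real (m x y) / real D"

lemma adj_sym: "x \<in> V \<Longrightarrow> y \<in> V \<Longrightarrow> adj x y = adj y x"
  by (simp add: edges_sym)

lemma adj_rows: "x \<in> V \<Longrightarrow> (\<Sum>y\<in>V. adj x y) = 1"
  using degree_pos regular by (simp flip: sum_divide_distrib of_nat_sum)

text \<open>An enumeration of the vertices carries the two matrix lemmas over to the graph. The
  multiset \<open>R\<close> may contain 1 again; describing its members without their multiplicities
  suffices, since one copy of 1 has been set aside.\<close>

lemma proots_char_poly:
  assumes vs: "distinct vs" "set vs = V"
  shows "\<exists>R. proots (char_poly (normalized_adj_mat vs m D)) = add_mset 1 R \<and>
    (\<forall>\<theta>. \<theta> \<in># R \<longleftrightarrow> (\<exists>f. (\<exists>x\<in>V. f x \<noteq> 0) \<and> (\<Sum>x\<in>V. f x) = 0 \<and>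
      (\<forall>x\<in>V. (\<Sum>y\<in>V. adj x y * f y) = \<theta> * f x)))"
proof -
  obtain k where k: "length vs = Suc k"
    using vs two_vertices by (metis Suc_le_D distinct_card numeral_2_eq_2)
  let ?a = "\<lambda>i j. adj (vs ! i) (vs ! j)"
  let ?M' = "mat k k (\<lambda>(i, j). ?a (Suc i) (Suc j) - ?a 0 (Suc j))"
  have bij: "bij_betw ((!) vs) {..<Suc k} V"
    using bij_betw_nth[OF vs(1), of "{..<Suc k}" V] vs k by simp
  have sums: "(\<Sum>i<Suc k. f (vs ! i)) = (\<Sum>x\<in>V. f x)" for f :: "'v \<Rightarrow> real"
    by (rule sum.reindex_bij_betw[OF bij])
  have mem: "vs ! i \<in> V" if "i < Suc k" for i
    using that vs k by (metis nth_mem)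
  have idx: "\<exists>i<Suc k. vs ! i = x" if "x \<in> V" for x
    using that vs k by (metis in_set_conv_nth)
  have rows: "(\<Sum>j<Suc k. ?a i j) = 1" if "i < Suc k" for i
    unfolding sums[of "adj (vs ! i)"] by (intro adj_rows mem that)
  have sym: "?a i j = ?a j i" if "i < Suc k" "j < Suc k" for i j
    using that by (intro adj_sym mem)
  have cp: "char_poly (normalized_adj_mat vs m D) = [:-1, 1:] * char_poly ?M'"
    unfolding normalized_adj_mat_def k by (rule char_poly_stochastic[OF rows])
  have "char_poly ?M' \<noteq> 0"
    using degree_monic_char_poly[of ?M' k] by auto
  then have R: "proots (char_poly (normalized_adj_mat vs m D)) = add_mset 1 (proots (char_poly ?M'))"
    and mem_iff: "\<theta> \<in># proots (char_poly ?M') \<longleftrightarrow> poly (char_poly ?M') \<theta> = 0" for \<theta>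
    unfolding cp by (auto simp: proots_mult simp del: mult_pCons_left)
  show ?thesis
  proof (intro exI[of _ "proots (char_poly ?M')"] conjI allI, rule R)
    fix \<theta>
    have "\<theta> \<in># proots (char_poly ?M') \<longleftrightarrow> (\<exists>f. (\<exists>i<Suc k. f i \<noteq> 0) \<and> (\<Sum>i<Suc k. f i) = 0 \<and>
        (\<forall>i<Suc k. (\<Sum>j<Suc k. ?a i j * f j) = \<theta> * f i))"
      unfolding mem_iff by (rule poly_char_poly_stochastic_quotient[OF rows sym])
    also have "\<dots> \<longleftrightarrow> (\<exists>f. (\<exists>x\<in>V. f x \<noteq> 0) \<and> (\<Sum>x\<in>V. f x) = 0 \<and>
          (\<forall>x\<in>V. (\<Sum>y\<in>V. adj x y * f y) = \<theta> * f x))" (is "(\<exists>f. ?P f) \<longleftrightarrow> (\<exists>f. ?Q f)")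
    proof
      assume "\<exists>f. ?P f"
      then obtain f where f: "?P f" by blast
      define g where "g x = f (the_inv_into {..<Suc k} ((!) vs) x)" for x
      have g: "g (vs ! i) = f i" if "i < Suc k" for i
        using that bij unfolding g_def by (simp add: the_inv_into_f_f bij_betw_def)
      have "(\<Sum>x\<in>V. g x) = (\<Sum>i<Suc k. f i)"
        unfolding sums[symmetric] by (intro sum.cong refl) (simp add: g)
      moreover have "(\<Sum>y\<in>V. adj (vs ! i) y * g y) = (\<Sum>j<Suc k. ?a i j * f j)" for i
        unfolding sums[of "\<lambda>y. adj (vs ! i) y * g y", symmetric] by (intro sum.cong refl) (simp add: g)
      moreover have "\<exists>x\<in>V. g x \<noteq> 0"
        using f g mem by metis
      ultimately have "?Q g"
        using f by (auto simp: g dest!: idx)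
      then show "\<exists>f. ?Q f" by blast
    next
      assume "\<exists>f. ?Q f"
      then obtain f where f: "?Q f" by blast
      have "\<exists>i<Suc k. f (vs ! i) \<noteq> 0"
        using f idx by metis
      then have "?P (\<lambda>i. f (vs ! i))"
        unfolding sums sums[of "\<lambda>y. adj (vs ! i) y * f y" for i] using f mem by blast
      then show "\<exists>f. ?P f" by (rule exI[where x = "\<lambda>i. f (vs ! i)"])
    qed
    finally show "\<theta> \<in># proots (char_poly ?M') \<longleftrightarrow> \<dots>" .
  qed
qed

text \<open>Let \<mu> be the top eigenvalue on mean-zero functions. The second entry of the list is
  at least the minimum of 1 and \<mu>, and since 1 - \<epsilon> lies below 1, a gap of \<epsilon>
  forces \<mu> \<le> 1 - \<epsilon>. Conversely the form is tested on an eigenvector whose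
  eigenvalue is at least the second entry.\<close>

lemma le_spectral_gap_iff:
  assumes "0 < \<epsilon>"
  shows "\<epsilon> \<le> spectral_gap V m D \<longleftrightarrow>
    (\<forall>g. (\<Sum>x\<in>V. g x) = 0 \<longrightarrow> bilin V adj g g \<le> (1 - \<epsilon>) * (\<Sum>x\<in>V. (g x)\<^sup>2))"
proof -
  define vs where "vs = (SOME vs. distinct vs \<and> set vs = V)"
  have vs: "distinct vs" "set vs = V"
    using someI_ex[of "\<lambda>vs. distinct vs \<and> set vs = V"] finite_distinct_list[OF finite_vertices]
    unfolding vs_def by auto
  obtain R where X: "proots (char_poly (normalized_adj_mat vs m D)) = add_mset 1 R"
    and R: "\<And>\<theta>. \<theta> \<in># R \<longleftrightarrow> (\<exists>f. (\<exists>x\<in>V. f x \<noteq> 0) \<and> (\<Sum>x\<in>V. f x) = 0 \<and>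
          (\<forall>x\<in>V. (\<Sum>y\<in>V. adj x y * f y) = \<theta> * f x))"
    using proots_char_poly[OF vs] by blast
  obtain \<mu> u where u: "(\<Sum>x\<in>V. u x) = 0" "\<exists>x\<in>V. u x \<noteq> 0"
    "\<And>x. x \<in> V \<Longrightarrow> (\<Sum>y\<in>V. adj x y * u y) = \<mu> * u x"
    and max: "\<And>g. (\<Sum>x\<in>V. g x) = 0 \<Longrightarrow> bilin V adj g g \<le> \<mu> * (\<Sum>x\<in>V. (g x)\<^sup>2)"
    using exists_top_eigenvector[OF finite_vertices two_vertices adj_sym adj_rows] by blast
  have "\<mu> \<in># R" using u R by blast
  then obtain R' where R': "R = add_mset \<mu> R'" by (metis multi_member_split)
  define \<theta>2 where "\<theta>2 = rev (sorted_list_of_multiset (add_mset 1 R)) ! 1"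
  have second: "t \<le> \<theta>2 \<longleftrightarrow> 2 \<le> size (filter_mset (\<lambda>x. t \<le> x) (add_mset 1 R))" for t
    unfolding \<theta>2_def by (rule le_second_largest_iff) (simp add: R')
  have gap: "spectral_gap V m D = 1 - \<theta>2"
    unfolding spectral_gap_def eigenvalues_decreasing_def vs_def[symmetric] X \<theta>2_def ..
  have "min 1 \<mu> \<le> \<theta>2" unfolding second by (simp add: R')
  show ?thesis
  proof
    assume "\<epsilon> \<le> spectral_gap V m D"
    then have "\<mu> \<le> 1 - \<epsilon>" using \<open>min 1 \<mu> \<le> \<theta>2\<close> \<open>0 < \<epsilon>\<close> unfolding gap by linarith
    then show "\<forall>g. (\<Sum>x\<in>V. g x) = 0 \<longrightarrow> bilin V adj g g \<le> (1 - \<epsilon>) * (\<Sum>x\<in>V. (g x)\<^sup>2)"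
      using max by (meson mult_right_mono order_trans sum_nonneg zero_le_power2)
  next
    assume form: "\<forall>g. (\<Sum>x\<in>V. g x) = 0 \<longrightarrow> bilin V adj g g \<le> (1 - \<epsilon>) * (\<Sum>x\<in>V. (g x)\<^sup>2)"
    \<comment> \<open>Two entries of \<open>add_mset 1 R\<close> reach the second largest one, and
      at most one of them is the separated 1.\<close>
    have "\<exists>\<theta>. \<theta> \<in># R \<and> \<theta>2 \<le> \<theta>"
    proof (rule ccontr)
      assume "\<not> ?thesis"
      then have none: "filter_mset (\<lambda>x. \<theta>2 \<le> x) R = {#}" by auto
      then show False using second[of \<theta>2] unfolding filter_mset_add_mset none by (simp split: if_splits)
    qed
    then obtain \<theta> f where "\<theta>2 \<le> \<theta>" and f: "\<exists>x\<in>V. f x \<noteq> 0" "(\<Sum>x\<in>V. f x) = 0"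
      "\<And>x. x \<in> V \<Longrightarrow> (\<Sum>y\<in>V. adj x y * f y) = \<theta> * f x"
      using R by blast
    have "bilin V adj f f = \<theta> * (\<Sum>x\<in>V. (f x)\<^sup>2)"
      unfolding bilin_def sum_distrib_left
      by (intro sum.cong refl) (simp only: f(3), simp add: power2_eq_square)
    then have "\<theta> * (\<Sum>x\<in>V. (f x)\<^sup>2) \<le> (1 - \<epsilon>) * (\<Sum>x\<in>V. (f x)\<^sup>2)"
      using form f(2) by metis
    moreover have "(\<Sum>x\<in>V. (f x)\<^sup>2) > 0"
      using f(1) finite_vertices by (meson sum_pos2 zero_less_power2 zero_le_power2)
    ultimately have "\<theta> \<le> 1 - \<epsilon>" by simp
    then show "\<epsilon> \<le> spectral_gap V m D" using \<open>\<theta>2 \<le> \<theta>\<close> unfolding gap by linarith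
  qed
qed

end

text \<open>Polarization: with \<open>k = a h\<close>, evaluate the form at \<open>h \<plusminus> k / \<rho>\<close>.\<close>

lemma bilin_contraction:
  fixes a :: "'v \<Rightarrow> 'v \<Rightarrow> real"
  assumes sym: "\<And>x y. x \<in> V \<Longrightarrow> y \<in> V \<Longrightarrow> a x y = a y x"
    and rows: "\<And>x. x \<in> V \<Longrightarrow> (\<Sum>y\<in>V. a x y) = 1"
    and "0 < \<rho>"
    and form: "\<And>g. (\<Sum>x\<in>V. g x) = 0 \<Longrightarrow> \<bar>bilin V a g g\<bar> \<le> \<rho> * (\<Sum>x\<in>V. (g x)\<^sup>2)"
    and h0: "(\<Sum>x\<in>V. h x) = 0"
  shows "(\<Sum>x\<in>V. \<Sum>y\<in>V. a x y * h y) = 0"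
    and "(\<Sum>x\<in>V. (\<Sum>y\<in>V. a x y * h y)\<^sup>2) \<le> \<rho>\<^sup>2 * (\<Sum>x\<in>V. (h x)\<^sup>2)"
proof -
  define k where "k x = (\<Sum>y\<in>V. a x y * h y)" for x
  have "(\<Sum>x\<in>V. k x) = bilin V a h (\<lambda>_. 1)"
    by (simp add: bilin_def k_def)
  also have "\<dots> = bilin V a (\<lambda>_. 1) h" by (rule bilin_commute[OF sym])
  also have "\<dots> = 0" using rows h0 by (simp add: bilin_def)
  finally have k0: "(\<Sum>x\<in>V. k x) = 0" .
  then show "(\<Sum>x\<in>V. \<Sum>y\<in>V. a x y * h y) = 0" by (simp add: k_def)
  have hk: "bilin V a h k = (\<Sum>x\<in>V. (k x)\<^sup>2)"
    by (simp add: bilin_def k_def power2_eq_square)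
  define t where "t = 1 / \<rho>"
  let ?p = "\<lambda>x. h x + t * k x" and ?q = "\<lambda>x. h x + (- t) * k x"
  have "4 * t * bilin V a h k = bilin V a ?p ?p - bilin V a ?q ?q"
    unfolding bilin_add_left bilin_add_right using bilin_commute[OF sym, where g = h and h = k]
    by (simp add: algebra_simps)
  also have "\<dots> \<le> \<rho> * (\<Sum>x\<in>V. (?p x)\<^sup>2) + \<rho> * (\<Sum>x\<in>V. (?q x)\<^sup>2)"
  proof -
    have "(\<Sum>x\<in>V. ?p x) = 0" "(\<Sum>x\<in>V. ?q x) = 0"
      unfolding sum.distrib sum_distrib_left[symmetric] by (simp_all add: h0 k0)
    from form[OF this(1)] form[OF this(2)] show ?thesis by linarith
  qed
  also have "\<dots> = 2 * \<rho> * ((\<Sum>x\<in>V. (h x)\<^sup>2) + t\<^sup>2 * (\<Sum>x\<in>V. (k x)\<^sup>2))"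
    by (simp add: power2_sum power2_diff sum.distrib sum_subtractf sum_distrib_left power_mult_distrib
        algebra_simps)
  finally have "2 * t * (\<Sum>x\<in>V. (k x)\<^sup>2) \<le>
      \<rho> * (\<Sum>x\<in>V. (h x)\<^sup>2) + \<rho> * t\<^sup>2 * (\<Sum>x\<in>V. (k x)\<^sup>2)"
    unfolding hk by (simp add: algebra_simps)
  \<comment> \<open>For this \<open>t\<close> the last term on the right is half of the left-hand
    side and is absorbed.\<close>
  then have "(\<Sum>x\<in>V. (k x)\<^sup>2) \<le> \<rho>\<^sup>2 * (\<Sum>x\<in>V. (h x)\<^sup>2)"
    using \<open>0 < \<rho>\<close> by (simp add: t_def power2_eq_square field_simps)
  then show "(\<Sum>x\<in>V. (\<Sum>y\<in>V. a x y * h y)\<^sup>2) \<le> \<rho>\<^sup>2 * (\<Sum>x\<in>V. (h x)\<^sup>2)"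
    by (simp add: k_def)
qed

subsection \<open>Random walks on finite groups\<close>

lemma sum_mset_sum_swap:
  fixes f :: "'a \<Rightarrow> 'b \<Rightarrow> 'c :: comm_monoid_add"
  shows "(\<Sum>t\<in>#M. \<Sum>x\<in>A. f t x) = (\<Sum>x\<in>A. \<Sum>t\<in>#M. f t x)"
  by (induction M) (simp_all add: sum.distrib)

lemma sum_mset_swap:
  fixes f :: "'a \<Rightarrow> 'b \<Rightarrow> 'c :: comm_monoid_add"
  shows "(\<Sum>t\<in>#M. \<Sum>x\<in>#A. f t x) = (\<Sum>x\<in>#A. \<Sum>t\<in>#M. f t x)"
  by (induction M) (simp_all add: sum_mset.distrib)

lemma sum_mset_image_sum_mset:
  fixes h :: "'b \<Rightarrow> 'c :: comm_monoid_add"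
  shows "(\<Sum>w\<in>#(\<Sum>s\<in>#M. F s). h w) = (\<Sum>s\<in>#M. \<Sum>w\<in>#F s. h w)"
  by (induction M) simp_all

lemma in_walk_ends_Suc_iff:
  "x \<in># walk_ends G S (Suc k) \<longleftrightarrow> (\<exists>w s. w \<in># walk_ends G S k \<and> s \<in># S \<and> x = w \<otimes>\<^bsub>G\<^esub> s)"
  by (auto simp: in_Union_mset_iff)

lemma size_walk_ends: "size (walk_ends G S k) = size S ^ k"
proof (induction k)
  case (Suc k)
  have "size (\<Sum>s\<in>#T. image_mset (\<lambda>w. w \<otimes>\<^bsub>G\<^esub> s) (walk_ends G S k)) = size T * size S ^ k" for T
    by (induction T) (simp_all add: Suc)
  then show ?case by simp
qed simp

text \<open>The Markov operator of the walk, available on infinite groups and on their finite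
  quotients alike.\<close>

definition step_avg :: "('a, 'b) monoid_scheme \<Rightarrow> 'a multiset \<Rightarrow> ('a \<Rightarrow> real) \<Rightarrow> 'a \<Rightarrow> real" where
  "step_avg G S h x = (\<Sum>s\<in>#S. h (x \<otimes>\<^bsub>G\<^esub> s)) / real (size S)"

lemma size_mult_step_avg:
  assumes "S \<noteq> {#}"
  shows "real (size S) * step_avg G S h x = (\<Sum>s\<in>#S. h (x \<otimes>\<^bsub>G\<^esub> s))"
proof -
  have "real (size S) * (t / real (size S)) = t" for t
    using assms by simp
  then show ?thesis unfolding step_avg_def .
qed

lemma sum_mset_nonneg:
  fixes f :: "'a \<Rightarrow> 'b :: ordered_comm_monoid_add"
  assumes "\<And>x. x \<in># M \<Longrightarrow> 0 \<le> f x"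
  shows "0 \<le> (\<Sum>x\<in>#M. f x)"
  using assms by (induction M) auto

text \<open>Peeling off the last step replaces \<open>h\<close> by its one-step average, hence the
  induction over all \<open>h\<close>. Bounds on powers of the Markov operator thereby become bounds
  on the walk started at the identity.\<close>

lemma sum_walk_ends:
  assumes "S \<noteq> {#}"
  shows "(\<Sum>w\<in>#walk_ends G S k. h w) = real (size S) ^ k * (step_avg G S ^^ k) h \<one>\<^bsub>G\<^esub>"
proof (induction k arbitrary: h)
  case (Suc k)
  have "(\<Sum>w\<in>#walk_ends G S (Suc k). h w) = (\<Sum>s\<in>#S. \<Sum>w\<in>#walk_ends G S k. h (w \<otimes>\<^bsub>G\<^esub> s))"
    by (simp add: sum_mset_image_sum_mset image_mset.compositionality comp_def)
  also have "\<dots> = (\<Sum>w\<in>#walk_ends G S k. real (size S) * step_avg G S h w)"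
    unfolding sum_mset_swap[of _ _ S] size_mult_step_avg[OF assms] ..
  also have "\<dots> = real (size S) ^ Suc k * (step_avg G S ^^ Suc k) h \<one>\<^bsub>G\<^esub>"
    by (simp add: Suc funpow_swap1 flip: sum_mset_distrib_left)
  finally show ?case .
qed simp

text \<open>Symmetry is recorded as invariance of the multiset under inversion, not through
  multiplicities: this form passes to quotients, where the multiplicities of different elements
  merge.\<close>

locale symmetric_walk = group G for G :: "('a, 'b) monoid_scheme" (structure) +
  fixes S :: "'a multiset"
  assumes steps_closed: "set_mset S \<subseteq> carrier G"
    and steps_inv: "image_mset (\<lambda>s. inv s) S = S"
    and steps_nonempty: "S \<noteq> {#}"
begin

lemma size_pos: "0 < size S"
  using steps_nonempty by (simp add: nonempty_has_size)

lemma walk_ends_closed: "w \<in># walk_ends G S n \<Longrightarrow> w \<in> carrier G"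
  using steps_closed by (induction n arbitrary: w) (auto simp: in_walk_ends_Suc_iff simp del: walk_ends.simps(2))

lemma walk_ends_mult:
  assumes "x \<in># walk_ends G S m" "y \<in># walk_ends G S n"
  shows "x \<otimes> y \<in># walk_ends G S (m + n)"
  using assms(2)
proof (induction n arbitrary: y)
  case 0
  then show ?case using assms(1) walk_ends_closed by simp
next
  case (Suc n)
  then obtain v s where "v \<in># walk_ends G S n" "s \<in># S" "y = v \<otimes> s"
    by (auto simp: in_walk_ends_Suc_iff simp del: walk_ends.simps(2))
  moreover from this have "x \<otimes> y = (x \<otimes> v) \<otimes> s"
    using assms(1) steps_closed walk_ends_closed by (metis m_assoc subsetD)
  ultimately show ?case
    using Suc.IH by (auto simp: in_walk_ends_Suc_iff simp del: walk_ends.simps(2))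
qed

lemma step_in_walk_ends: "s \<in># S \<Longrightarrow> s \<in># walk_ends G S 1"
  using steps_closed by (force simp: in_walk_ends_Suc_iff simp del: walk_ends.simps(2))

lemma inv_in_steps: "s \<in># S \<Longrightarrow> inv s \<in># S"
  using steps_inv by (metis image_eqI set_image_mset)

lemma walk_ends_inv: "x \<in># walk_ends G S n \<Longrightarrow> inv x \<in># walk_ends G S n"
proof (induction n arbitrary: x)
  case (Suc n)
  then obtain v s where v: "v \<in># walk_ends G S n" and s: "s \<in># S" and x: "x = v \<otimes> s"
    by (auto simp: in_walk_ends_Suc_iff simp del: walk_ends.simps(2))
  have "inv x = inv s \<otimes> inv v"
    using v s x steps_closed walk_ends_closed by (metis inv_mult_group subsetD)
  moreover have "inv s \<otimes> inv v \<in># walk_ends G S (1 + n)"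
    by (intro walk_ends_mult step_in_walk_ends inv_in_steps s Suc.IH v)
  ultimately show ?case by simp
qed simp

lemma reachable:
  assumes "generates G S" and "x \<in> carrier G"
  shows "\<exists>n. x \<in># walk_ends G S n"
proof -
  have "x \<in> generate G (set_mset S)" using assms by (simp add: generates_def)
  then show ?thesis
  proof (induction rule: generate.induct)
    case one
    have "\<one> \<in># walk_ends G S 0" by simp
    then show ?case by blast
  next
    case (incl h)
    then show ?case using step_in_walk_ends by blast
  next
    case (inv h)
    then show ?case using step_in_walk_ends inv_in_steps by blast
  next
    case (eng h1 h2)
    then show ?case using walk_ends_mult by blast
  qed
qed

text \<open>If every closed walk had even length, the parity of the length of a walk from the
  identity to x would depend on x alone, and the two parity classes would be a bipartition.\<close>

lemma odd_closed_walk: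
  assumes "generates G S" and "\<not> bipartite (carrier G) (cayley_edges G S)"
  shows "\<exists>n. odd n \<and> \<one> \<in># walk_ends G S n"
proof (rule ccontr)
  assume none: "\<not> ?thesis"
  define A where "A = {x. \<exists>n. even n \<and> x \<in># walk_ends G S n}"
  define B where "B = {x. \<exists>n. odd n \<and> x \<in># walk_ends G S n}"
  have union: "A \<union> B = carrier G"
  proof (intro equalityI subsetI)
    fix x assume "x \<in> carrier G"
    then obtain n where "x \<in># walk_ends G S n" using reachable[OF assms(1)] by blast
    then show "x \<in> A \<union> B" by (cases "even n") (auto simp: A_def B_def)
  qed (auto simp: A_def B_def intro: walk_ends_closed)
  have disj: "A \<inter> B = {}"
  proof (rule ccontr)
    assume "A \<inter> B \<noteq> {}"
    then obtain x m n where x: "even m" "x \<in># walk_ends G S m" "odd n" "x \<in># walk_ends G S n"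
      by (auto simp: A_def B_def)
    \<comment> \<open>Out along one walk and back along the inverse of the other: a closed walk of
      odd length.\<close>
    have "x \<otimes> inv x \<in># walk_ends G S (m + n)"
      using x by (intro walk_ends_mult walk_ends_inv)
    then have "\<one> \<in># walk_ends G S (m + n)" using walk_ends_closed[OF x(2)] by simp
    moreover have "odd (m + n)" using x by simp
    ultimately show False using none by blast
  qed
  have edge: "(x \<in> A \<and> y \<in> B) \<or> (x \<in> B \<and> y \<in> A)"
    if x: "x \<in> carrier G" and "0 < cayley_edges G S x y" for x y
  proof -
    have "filter_mset (\<lambda>s. x \<otimes> s = y) S \<noteq> {#}"
      using that by (metis cayley_edges_def less_irrefl size_empty)
    then obtain s where s: "s \<in># S" "y = x \<otimes> s" by auto
    obtain n where n: "x \<in># walk_ends G S n" using reachable[OF assms(1) x] by blast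
    have y: "y \<in># walk_ends G S (Suc n)"
      unfolding in_walk_ends_Suc_iff using n s by blast
    show ?thesis
    proof (cases "even n")
      case True
      then have "odd (Suc n)" by simp
      then show ?thesis using True n y unfolding A_def B_def by blast
    next
      case False
      then have "even (Suc n)" by simp
      then show ?thesis using False n y unfolding A_def B_def by blast
    qed
  qed
  have "bipartite (carrier G) (cayley_edges G S)"
    unfolding bipartite_def
    by (intro exI[of _ A] exI[of _ B] conjI ballI impI union disj edge)
  then show False using assms(2) by contradiction
qed

end

section \<open>Spectral estimates for walks on a finite group\<close>

locale finite_symmetric_walk = symmetric_walk +
  assumes finite_carrier: "finite (carrier G)"
begin

abbreviation transition :: "'a \<Rightarrow> 'a \<Rightarrow> real" where
  "transition x y \<equiv> real (cayley_edges G S x y) / real (size S)"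

lemma sum_cayley_edges:
  fixes h :: "'a \<Rightarrow> real"
  assumes "x \<in> carrier G"
  shows "(\<Sum>y\<in>carrier G. real (cayley_edges G S x y) * h y) = (\<Sum>s\<in>#S. h (x \<otimes> s))"
proof -
  have "(\<Sum>y\<in>carrier G. real (size (filter_mset (\<lambda>s. x \<otimes> s = y) T)) * h y) = (\<Sum>s\<in>#T. h (x \<otimes> s))"
    if "set_mset T \<subseteq> carrier G" for T
    using that
  proof (induction T)
    case (add s T)
    have "(\<Sum>y\<in>carrier G. real (size (filter_mset (\<lambda>s. x \<otimes> s = y) (add_mset s T))) * h y) =
        (\<Sum>y\<in>carrier G. (if y = x \<otimes> s then h y else 0) +
          real (size (filter_mset (\<lambda>s. x \<otimes> s = y) T)) * h y)"
      by (intro sum.cong refl) (simp add: algebra_simps)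
    also have "\<dots> = h (x \<otimes> s) + (\<Sum>s\<in>#T. h (x \<otimes> s))"
      using add assms finite_carrier by (simp add: sum.distrib)
    finally show ?case by simp
  qed simp
  then show ?thesis using steps_closed by (simp add: cayley_edges_def)
qed

lemma sum_transition:
  assumes "x \<in> carrier G"
  shows "(\<Sum>y\<in>carrier G. transition x y * h y) = step_avg G S h x"
  using sum_cayley_edges[OF assms] by (simp add: step_avg_def flip: sum_divide_distrib)

lemma cayley_edges_sym:
  assumes "x \<in> carrier G" "y \<in> carrier G"
  shows "cayley_edges G S x y = cayley_edges G S y x"
proof -
  have "cayley_edges G S y x = size (filter_mset (\<lambda>s. y \<otimes> s = x) (image_mset (\<lambda>s. inv s) S))"
    by (simp add: cayley_edges_def steps_inv)
  also have "\<dots> = size (filter_mset (\<lambda>s. y \<otimes> inv s = x) S)"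
    by (simp add: filter_mset_image_mset)
  also have "filter_mset (\<lambda>s. y \<otimes> inv s = x) S = filter_mset (\<lambda>s. x \<otimes> s = y) S"
  proof (rule filter_mset_cong[OF refl])
    fix s assume "s \<in># S"
    then have "s \<in> carrier G" using steps_closed by blast
    then show "(y \<otimes> inv s = x) = (x \<otimes> s = y)"
      using assms by (metis inv_solve_right)
  qed
  finally show ?thesis by (simp add: cayley_edges_def)
qed

lemma transition_sym: "x \<in> carrier G \<Longrightarrow> y \<in> carrier G \<Longrightarrow> transition x y = transition y x"
  by (simp add: cayley_edges_sym)

lemma transition_rows: "x \<in> carrier G \<Longrightarrow> (\<Sum>y\<in>carrier G. transition x y) = 1"
  using sum_transition[of x "\<lambda>_. 1"] by (simp add: step_avg_def steps_nonempty)

lemma bilin_transition: "bilin (carrier G) transition g h = (\<Sum>x\<in>carrier G. step_avg G S g x * h x)"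
  unfolding bilin_def by (intro sum.cong refl) (simp only: sum_transition)

text \<open>With a single element the only mean-zero function is 0 on the carrier, so the form
  condition holds trivially, in agreement with the convention for one vertex.\<close>

lemma expander_iff:
  assumes "0 < \<epsilon>"
  shows "expander \<epsilon> (carrier G) (cayley_edges G S) (size S) \<longleftrightarrow>
    (\<forall>g. (\<Sum>x\<in>carrier G. g x) = 0 \<longrightarrow>
      (\<Sum>x\<in>carrier G. step_avg G S g x * g x) \<le> (1 - \<epsilon>) * (\<Sum>x\<in>carrier G. (g x)\<^sup>2))"
proof (cases "2 \<le> card (carrier G)")
  case True
  have reg: "(\<Sum>y\<in>carrier G. cayley_edges G S x y) = size S" if "x \<in> carrier G" for x
  proof -
    have "real (\<Sum>y\<in>carrier G. cayley_edges G S x y) = real (size S)"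
      using sum_cayley_edges[OF that, of "\<lambda>_. 1"] by simp
    then show ?thesis by (simp only: of_nat_eq_iff)
  qed
  interpret regular_graph "carrier G" "cayley_edges G S" "size S"
    by unfold_locales (use finite_carrier True size_pos cayley_edges_sym reg in auto)
  show ?thesis
    using True finite_carrier by (simp add: expander_def le_spectral_gap_iff[OF assms] bilin_transition)
next
  case False
  moreover have "card (carrier G) \<noteq> 0" using finite_carrier by auto
  ultimately have "card (carrier G) = 1" by linarith
  then obtain z where "carrier G = {z}" by (metis card_1_singletonE)
  then show ?thesis by (simp add: expander_def)
qed

lemma sum_shift:
  fixes f :: "'a \<Rightarrow> real"
  assumes "w \<in> carrier G"
  shows "(\<Sum>x\<in>carrier G. f (x \<otimes> w)) = (\<Sum>x\<in>carrier G. f x)"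
proof (rule sum.reindex_bij_betw)
  show "bij_betw (\<lambda>x. x \<otimes> w) (carrier G) (carrier G)"
    by (rule bij_betw_byWitness[where f' = "\<lambda>x. x \<otimes> inv w"]) (use assms in \<open>auto simp: m_assoc\<close>)
qed

text \<open>For \<sigma> = 1 this is, up to normalization, the Dirichlet form, which controls the
  spectrum near 1; for \<sigma> = -1 it is its signless counterpart, which controls the spectrum
  near -1. The parameter lets one telescoping argument serve both.\<close>

definition energy :: "real \<Rightarrow> ('a \<Rightarrow> real) \<Rightarrow> real" where
  "energy \<sigma> h = (\<Sum>s\<in>#S. \<Sum>x\<in>carrier G. (h x - \<sigma> * h (x \<otimes> s))\<^sup>2)"

text \<open>Expand the squares: right translation by a step permutes the group, so both square terms
  have the same sum.\<close>

lemma energy_eq: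
  assumes "\<sigma>\<^sup>2 = 1"
  shows "energy \<sigma> h = 2 * real (size S) *
    ((\<Sum>x\<in>carrier G. (h x)\<^sup>2) - \<sigma> * (\<Sum>x\<in>carrier G. step_avg G S h x * h x))"
proof -
  have "energy \<sigma> h = (\<Sum>s\<in>#S. 2 * (\<Sum>x\<in>carrier G. (h x)\<^sup>2) - 2 * \<sigma> * (\<Sum>x\<in>carrier G. h (x \<otimes> s) * h x))"
    unfolding energy_def
  proof (intro arg_cong[of _ _ sum_mset] image_mset_cong)
    fix s assume "s \<in># S"
    then have s: "s \<in> carrier G" using steps_closed by blast
    have "(\<Sum>x\<in>carrier G. (h x - \<sigma> * h (x \<otimes> s))\<^sup>2) =
        (\<Sum>x\<in>carrier G. (h x)\<^sup>2) + (\<Sum>x\<in>carrier G. (h (x \<otimes> s))\<^sup>2) -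
        2 * \<sigma> * (\<Sum>x\<in>carrier G. h (x \<otimes> s) * h x)"
      using assms by (simp add: power2_diff power_mult_distrib sum.distrib sum_subtractf sum_distrib_left mult_ac)
    then show "(\<Sum>x\<in>carrier G. (h x - \<sigma> * h (x \<otimes> s))\<^sup>2) =
        2 * (\<Sum>x\<in>carrier G. (h x)\<^sup>2) - 2 * \<sigma> * (\<Sum>x\<in>carrier G. h (x \<otimes> s) * h x)"
      using sum_shift[OF s, of "\<lambda>x. (h x)\<^sup>2"] by simp
  qed
  also have "\<dots> = 2 * real (size S) * (\<Sum>x\<in>carrier G. (h x)\<^sup>2) -
      2 * \<sigma> * (\<Sum>s\<in>#S. \<Sum>x\<in>carrier G. h (x \<otimes> s) * h x)"
    by (induction S) (simp_all add: algebra_simps)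
  also have "(\<Sum>s\<in>#S. \<Sum>x\<in>carrier G. h (x \<otimes> s) * h x) =
      real (size S) * (\<Sum>x\<in>carrier G. step_avg G S h x * h x)"
    unfolding sum_mset_sum_swap sum_distrib_left mult.assoc[symmetric]
      size_mult_step_avg[OF steps_nonempty] sum_mset_distrib_right ..
  finally show ?thesis by (simp add: algebra_simps)
qed

lemma energy_nonneg: "0 \<le> energy \<sigma> h"
  unfolding energy_def by (intro sum_mset_nonneg sum_nonneg) simp

text \<open>Telescoping along the word with the triangle inequality. Up to a sign each increment is
  a translate of the increment of a single step, and translation preserves the norm.\<close>

lemma L2_set_word_le:
  assumes "\<sigma>\<^sup>2 = 1" and "w \<in># walk_ends G S n"
  shows "L2_set (\<lambda>x. h x - \<sigma> ^ n * h (x \<otimes> w)) (carrier G) \<le> real n * sqrt (energy \<sigma> h)"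
  using assms(2)
proof (induction n arbitrary: w)
  case 0
  then show ?case by (simp add: L2_set_def)
next
  case (Suc n)
  then obtain v s where v: "v \<in># walk_ends G S n" and s: "s \<in># S" and w: "w = v \<otimes> s"
    by (auto simp: in_walk_ends_Suc_iff simp del: walk_ends.simps(2))
  have vc: "v \<in> carrier G" and sc: "s \<in> carrier G"
    using walk_ends_closed[OF v] s steps_closed by auto
  have pow: "(\<sigma> ^ n)\<^sup>2 = 1"
    using assms(1) by (metis power_commutes power_mult power_one mult.commute)
  have "L2_set (\<lambda>x. h x - \<sigma> ^ Suc n * h (x \<otimes> w)) (carrier G) =
      L2_set (\<lambda>x. (h x - \<sigma> ^ n * h (x \<otimes> v)) +
        \<sigma> ^ n * (h (x \<otimes> v) - \<sigma> * h (x \<otimes> v \<otimes> s))) (carrier G)"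
    using vc sc by (intro L2_set_cong refl) (simp add: w m_assoc algebra_simps)
  also have "\<dots> \<le> L2_set (\<lambda>x. h x - \<sigma> ^ n * h (x \<otimes> v)) (carrier G) +
      L2_set (\<lambda>x. \<sigma> ^ n * (h (x \<otimes> v) - \<sigma> * h (x \<otimes> v \<otimes> s))) (carrier G)"
    by (rule L2_set_triangle_ineq)
  also have "L2_set (\<lambda>x. \<sigma> ^ n * (h (x \<otimes> v) - \<sigma> * h (x \<otimes> v \<otimes> s))) (carrier G) =
      sqrt (\<Sum>x\<in>carrier G. (h x - \<sigma> * h (x \<otimes> s))\<^sup>2)"
    unfolding L2_set_def power_mult_distrib pow
    using sum_shift[OF vc, of "\<lambda>x. (h x - \<sigma> * h (x \<otimes> s))\<^sup>2"] by simp
  \<comment> \<open>The increment of the step \<open>s\<close> is one of the nonnegative summands of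
    the energy.\<close>
  also have "\<dots> \<le> sqrt (energy \<sigma> h)"
  proof -
    obtain T where T: "S = add_mset s T" using s by (metis multi_member_split)
    have "0 \<le> (\<Sum>s\<in>#T. \<Sum>x\<in>carrier G. (h x - \<sigma> * h (x \<otimes> s))\<^sup>2)"
      by (intro sum_mset_nonneg sum_nonneg) simp
    then show ?thesis unfolding energy_def by (subst T) simp
  qed
  finally show ?case using Suc.IH[OF v] by (simp add: algebra_simps)
qed

text \<open>Around a closed walk of odd length, \<open>2 h x\<close> is the alternating sum of the terms
  \<open>h y + h (y \<otimes> s)\<close> along the walk.\<close>

lemma step_avg_form_ge:
  assumes "\<one> \<in># walk_ends G S n" and "odd n"
  shows "- (1 - 2 / (real n ^ 2 * real (size S))) * (\<Sum>x\<in>carrier G. (h x)\<^sup>2) \<le>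
    (\<Sum>x\<in>carrier G. step_avg G S h x * h x)"
proof -
  let ?A = "\<Sum>x\<in>carrier G. (h x)\<^sup>2" and ?B = "\<Sum>x\<in>carrier G. step_avg G S h x * h x"
  have n: "real n > 0" using assms(2) by (auto elim: oddE)
  have "L2_set (\<lambda>x. h x - (-1) ^ n * h (x \<otimes> \<one>)) (carrier G) \<le> real n * sqrt (energy (-1) h)"
    by (rule L2_set_word_le) (use assms in auto)
  also have "L2_set (\<lambda>x. h x - (-1) ^ n * h (x \<otimes> \<one>)) (carrier G) = L2_set (\<lambda>x. 2 * h x) (carrier G)"
    using assms(2) by (intro L2_set_cong refl) simp
  finally have "(L2_set (\<lambda>x. 2 * h x) (carrier G))\<^sup>2 \<le> (real n * sqrt (energy (-1) h))\<^sup>2"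
    by (intro power_mono) auto
  moreover have "(L2_set (\<lambda>x. 2 * h x) (carrier G))\<^sup>2 = 4 * ?A"
    by (simp add: L2_set_def sum_nonneg power_mult_distrib flip: sum_distrib_left)
  moreover have "(real n * sqrt (energy (-1) h))\<^sup>2 = real n ^ 2 * (2 * real (size S) * (?A + ?B))"
    using energy_eq[of "-1" h] energy_nonneg[of "-1" h] by (simp add: power_mult_distrib)
  \<comment> \<open>Source of the constant in the statement: 4 comes from the squared norm of 2h, 2
    * \<open>size S\<close> from \<open>energy_eq\<close>, and n^2 from the length of the closed
    walk.\<close>
  ultimately have "4 * ?A \<le> real n ^ 2 * (2 * real (size S) * (?A + ?B))" by simp
  then have "2 / (real n ^ 2 * real (size S)) * ?A \<le> ?A + ?B"
    using n size_pos by (simp add: field_simps)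
  then show ?thesis by (simp add: algebra_simps)
qed

lemma step_avg_funpow:
  assumes "0 < \<rho>"
    and form: "\<And>g. (\<Sum>x\<in>carrier G. g x) = 0 \<Longrightarrow>
      \<bar>\<Sum>x\<in>carrier G. step_avg G S g x * g x\<bar> \<le> \<rho> * (\<Sum>x\<in>carrier G. (g x)\<^sup>2)"
    and "(\<Sum>x\<in>carrier G. h x) = 0"
  shows "(\<Sum>x\<in>carrier G. (step_avg G S ^^ k) h x) = 0 \<and>
    (\<Sum>x\<in>carrier G. ((step_avg G S ^^ k) h x)\<^sup>2) \<le> (\<rho> ^ k)\<^sup>2 * (\<Sum>x\<in>carrier G. (h x)\<^sup>2)"
proof (induction k)
  case (Suc k)
  let ?h = "(step_avg G S ^^ k) h"
  have eq: "(\<Sum>x\<in>carrier G. F (step_avg G S ?h x)) = (\<Sum>x\<in>carrier G. F (\<Sum>y\<in>carrier G. transition x y * ?h y))"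
    for F :: "real \<Rightarrow> real"
    by (intro sum.cong refl) (simp only: sum_transition)
  have "(\<Sum>x\<in>carrier G. step_avg G S ?h x) = 0"
    and "(\<Sum>x\<in>carrier G. (step_avg G S ?h x)\<^sup>2) \<le> \<rho>\<^sup>2 * (\<Sum>x\<in>carrier G. (?h x)\<^sup>2)"
    using bilin_contraction[of "carrier G" transition \<rho> ?h, OF transition_sym transition_rows \<open>0 < \<rho>\<close>]
      form Suc.IH unfolding eq[of "\<lambda>x. x\<^sup>2"] eq[of "\<lambda>x. x"] bilin_transition by auto
  moreover have "\<rho>\<^sup>2 * (\<Sum>x\<in>carrier G. (?h x)\<^sup>2) \<le> \<rho>\<^sup>2 * ((\<rho> ^ k)\<^sup>2 * (\<Sum>x\<in>carrier G. (h x)\<^sup>2))"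
    using Suc.IH by (intro mult_left_mono) auto
  ultimately show ?case by (simp add: power_mult_distrib mult_ac)
qed (use assms in simp)

text \<open>After subtraction of the mean, the error is the value at \<one> of the k-th power of the
  Markov operator on a mean-zero function. A point value is at most the L2 norm, which shrinks by
  \<rho> at each step.\<close>

lemma equidistribution:
  assumes "0 < \<rho>"
    and form: "\<And>g. (\<Sum>x\<in>carrier G. g x) = 0 \<Longrightarrow>
      \<bar>\<Sum>x\<in>carrier G. step_avg G S g x * g x\<bar> \<le> \<rho> * (\<Sum>x\<in>carrier G. (g x)\<^sup>2)"
    and h: "\<And>x. x \<in> carrier G \<Longrightarrow> \<bar>h x\<bar> \<le> 1"
  shows "\<bar>(\<Sum>w\<in>#walk_ends G S k. h w) / real (size S) ^ k -
      (\<Sum>x\<in>carrier G. h x) / real (card (carrier G))\<bar> \<le> real (card (carrier G)) * \<rho> ^ k"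
proof -
  let ?n = "real (card (carrier G))"
  have "card (carrier G) > 0" using finite_carrier by (metis card_gt_0_iff one_closed empty_iff)
  then have n: "?n \<ge> 1" by simp
  define \<mu> where "\<mu> = (\<Sum>x\<in>carrier G. h x) / ?n"
  define g where "g x = h x - \<mu>" for x
  have g0: "(\<Sum>x\<in>carrier G. g x) = 0"
    using n by (simp add: g_def sum_subtractf \<mu>_def)
  \<comment> \<open>Arranged so that the cross term is a multiple of \<open>g\<close> and sums to
    0.\<close>
  have "(\<Sum>x\<in>carrier G. (g x)\<^sup>2) = (\<Sum>x\<in>carrier G. (h x)\<^sup>2 - \<mu>\<^sup>2 - 2 * \<mu> * g x)"
    by (intro sum.cong refl) (simp add: g_def power2_eq_square algebra_simps)
  also have "\<dots> = (\<Sum>x\<in>carrier G. (h x)\<^sup>2) - ?n * \<mu>\<^sup>2"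
    by (simp add: sum_subtractf g0 flip: sum_distrib_left)
  also have "\<dots> \<le> (\<Sum>x\<in>carrier G. (h x)\<^sup>2)" by simp
  also have "\<dots> \<le> (\<Sum>x\<in>carrier G. 1)"
    using h by (intro sum_mono) (simp add: abs_square_le_1)
  also have "\<dots> = ?n" by simp
  also have "\<dots> \<le> ?n\<^sup>2" using n by (rule self_le_power) simp
  finally have gn: "(\<Sum>x\<in>carrier G. (g x)\<^sup>2) \<le> ?n\<^sup>2" .
  have "(\<Sum>w\<in>#walk_ends G S k. g w) = (\<Sum>w\<in>#walk_ends G S k. h w) - real (size S) ^ k * \<mu>"
  proof -
    have "(\<Sum>w\<in>#W. g w) = (\<Sum>w\<in>#W. h w) - real (size W) * \<mu>" for W
      by (induction W) (simp_all add: g_def algebra_simps)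
    then show ?thesis by (simp add: size_walk_ends)
  qed
  then have "(\<Sum>w\<in>#walk_ends G S k. h w) =
      real (size S) ^ k * (step_avg G S ^^ k) g \<one> + real (size S) ^ k * \<mu>"
    unfolding sum_walk_ends[OF steps_nonempty, where h = g] by (simp add: algebra_simps)
  moreover have "(d * t + d * \<mu>) / d - \<mu> = t" if "d > 0" for d t :: real
    using that by (simp add: field_simps)
  ultimately have "(\<Sum>w\<in>#walk_ends G S k. h w) / real (size S) ^ k - \<mu> = (step_avg G S ^^ k) g \<one>"
    using size_pos by (metis of_nat_0_less_iff zero_less_power)
  also have "\<bar>\<dots>\<bar> \<le> ?n * \<rho> ^ k"
  proof (rule power2_le_imp_le)
    have "((step_avg G S ^^ k) g \<one>)\<^sup>2 \<le> (\<Sum>x\<in>carrier G. ((step_avg G S ^^ k) g x)\<^sup>2)"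
      using finite_carrier by (intro member_le_sum) auto
    also have "\<dots> \<le> (\<rho> ^ k)\<^sup>2 * (\<Sum>x\<in>carrier G. (g x)\<^sup>2)"
      using step_avg_funpow[OF assms(1,2) g0] by simp
    also have "\<dots> \<le> (\<rho> ^ k)\<^sup>2 * ?n\<^sup>2" using gn by (intro mult_left_mono) auto
    finally show "\<bar>(step_avg G S ^^ k) g \<one>\<bar>\<^sup>2 \<le> (?n * \<rho> ^ k)\<^sup>2"
      by (simp add: power_mult_distrib mult_ac)
  qed (use \<open>0 < \<rho>\<close> in simp)
  finally show ?thesis by (simp add: \<mu>_def)
qed

lemma energy_le:
  assumes "s \<in># walk_ends G S n" "n \<le> L"
  shows "(\<Sum>x\<in>carrier G. (h x - h (x \<otimes> s))\<^sup>2) \<le> (real L)\<^sup>2 * energy 1 h"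
proof -
  have "L2_set (\<lambda>x. h x - h (x \<otimes> s)) (carrier G) \<le> real n * sqrt (energy 1 h)"
    using L2_set_word_le[of 1 s n h] assms by simp
  also have "\<dots> \<le> real L * sqrt (energy 1 h)"
    using assms by (intro mult_right_mono) (simp_all add: energy_nonneg)
  finally have "(L2_set (\<lambda>x. h x - h (x \<otimes> s)) (carrier G))\<^sup>2 \<le> (real L * sqrt (energy 1 h))\<^sup>2"
    by (intro power_mono) auto
  then show ?thesis
    by (simp add: L2_set_def sum_nonneg power_mult_distrib energy_nonneg)
qed

text \<open>Every step of \<open>T\<close> is a word of length at most \<open>L\<close> in
  \<open>S\<close>, so the energy for \<open>T\<close> is at most \<open>size T\<close> times L^2
  times the energy for \<open>S\<close>. By \<open>energy_eq\<close> the factor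
  \<open>size T\<close> cancels and \<open>size S\<close> remains. The loss involves no data of the
  group beyond \<open>L\<close> and \<open>size S\<close>, so it is the same for all
  quotients.\<close>

lemma expander_compare:
  assumes "finite_symmetric_walk G T" and "0 < \<epsilon>" and "0 < L"
    and exp: "expander \<epsilon> (carrier G) (cayley_edges G T) (size T)"
    and words: "\<And>t. t \<in># T \<Longrightarrow> \<exists>n\<le>L. t \<in># walk_ends G S n"
  shows "expander (\<epsilon> / ((real L)\<^sup>2 * real (size S))) (carrier G) (cayley_edges G S) (size S)"
proof -
  interpret T: finite_symmetric_walk G T by fact
  let ?K = "(real L)\<^sup>2 * real (size S)"
  have K: "?K > 0" using assms size_pos by simp
  have T0: "real (size T) > 0" using T.size_pos by simp
  show ?thesis
  proof (subst expander_iff)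
    show "\<epsilon> / ?K > 0" using assms K by simp
    show "\<forall>g. (\<Sum>x\<in>carrier G. g x) = 0 \<longrightarrow>
      (\<Sum>x\<in>carrier G. step_avg G S g x * g x) \<le> (1 - \<epsilon> / ?K) * (\<Sum>x\<in>carrier G. (g x)\<^sup>2)"
    proof (intro allI impI)
      fix g :: "'a \<Rightarrow> real" assume g0: "(\<Sum>x\<in>carrier G. g x) = 0"
      let ?N = "\<Sum>x\<in>carrier G. (g x)\<^sup>2"
      have "(\<Sum>x\<in>carrier G. step_avg G T g x * g x) \<le> (1 - \<epsilon>) * ?N"
        using exp g0 unfolding T.expander_iff[OF assms(2)] by blast
      then have "\<epsilon> * ?N \<le> ?N - (\<Sum>x\<in>carrier G. step_avg G T g x * g x)"
        by (simp add: algebra_simps)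
      then have "2 * real (size T) * (\<epsilon> * ?N) \<le>
          2 * real (size T) * (?N - (\<Sum>x\<in>carrier G. step_avg G T g x * g x))"
        by (rule mult_left_mono) simp
      also have "\<dots> = T.energy 1 g" using T.energy_eq[of 1 g] by simp
      also have "T.energy 1 g \<le> (\<Sum>t\<in>#T. (real L)\<^sup>2 * energy 1 g)"
        unfolding T.energy_def
      proof (rule sum_mset_mono)
        fix t assume "t \<in># T"
        then obtain n where "n \<le> L" "t \<in># walk_ends G S n" using words by blast
        then show "(\<Sum>x\<in>carrier G. (g x - 1 * g (x \<otimes> t))\<^sup>2) \<le> (real L)\<^sup>2 * energy 1 g"
          using energy_le[of t n L g] by simp
      qed
      also have "\<dots> = real (size T) * ((real L)\<^sup>2 * energy 1 g)" by simp
      finally have "2 * (\<epsilon> * ?N) \<le> (real L)\<^sup>2 * energy 1 g"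
        using T0 by simp
      then have "\<epsilon> * ?N \<le> ?K * (?N - (\<Sum>x\<in>carrier G. step_avg G S g x * g x))"
        using energy_eq[of 1 g] by (simp add: algebra_simps)
      then have "\<epsilon> * ?N / ?K \<le> ?N - (\<Sum>x\<in>carrier G. step_avg G S g x * g x)"
        using K by (simp only: pos_divide_le_eq mult.commute[of _ ?K])
      then show "(\<Sum>x\<in>carrier G. step_avg G S g x * g x) \<le> (1 - \<epsilon> / ?K) * ?N"
        by (simp add: left_diff_distrib)
    qed
  qed
qed

text \<open>In the maximum, 1 - \<epsilon> bounds the form from above by expansion, the last entry
  bounds it from below by the odd closed walk, and 1/2 keeps \<rho> positive, as the contraction
  estimate divides by it.\<close>

lemma equidistribution_of_expander:
  assumes "0 < \<epsilon>" and exp: "expander \<epsilon> (carrier G) (cayley_edges G S) (size S)"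
    and "\<one> \<in># walk_ends G S n" and "odd n"
    and \<rho>: "\<rho> = max (1 / 2) (max (1 - \<epsilon>) (1 - 2 / ((real n)\<^sup>2 * real (size S))))"
    and h: "\<And>x. x \<in> carrier G \<Longrightarrow> \<bar>h x\<bar> \<le> 1"
  shows "\<bar>(\<Sum>w\<in>#walk_ends G S k. h w) / real (size S) ^ k -
      (\<Sum>x\<in>carrier G. h x) / real (card (carrier G))\<bar> \<le> real (card (carrier G)) * \<rho> ^ k"
proof (rule equidistribution[OF _ _ h])
  show "0 < \<rho>" by (simp add: \<rho>)
next
  fix g :: "'a \<Rightarrow> real" assume g0: "(\<Sum>x\<in>carrier G. g x) = 0"
  let ?N = "\<Sum>x\<in>carrier G. (g x)\<^sup>2" and ?B = "\<Sum>x\<in>carrier G. step_avg G S g x * g x"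
  have N: "?N \<ge> 0" by (simp add: sum_nonneg)
  have "?B \<le> (1 - \<epsilon>) * ?N" using exp g0 unfolding expander_iff[OF assms(1)] by blast
  also have "\<dots> \<le> \<rho> * ?N" using N by (intro mult_right_mono) (auto simp: \<rho>)
  finally have up: "?B \<le> \<rho> * ?N" .
  have "(1 - 2 / ((real n)\<^sup>2 * real (size S))) * ?N \<le> \<rho> * ?N"
    using N by (intro mult_right_mono) (auto simp: \<rho>)
  then have "- (\<rho> * ?N) \<le> ?B" using step_avg_form_ge[OF assms(3,4), of g]
    unfolding mult_minus_left by linarith
  then show "\<bar>?B\<bar> \<le> \<rho> * ?N" using up by simp
qed

end

subsection \<open>Second moments\<close>

definition mset_avg :: "'a multiset \<Rightarrow> ('a \<Rightarrow> real) \<Rightarrow> real" where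
  "mset_avg W f = (\<Sum>w\<in>#W. f w) / real (size W)"

lemma mset_avg_cong: "(\<And>w. w \<in># W \<Longrightarrow> f w = g w) \<Longrightarrow> mset_avg W f = mset_avg W g"
  by (simp add: mset_avg_def cong: image_mset_cong)

lemma mset_avg_mono: "(\<And>w. w \<in># W \<Longrightarrow> f w \<le> g w) \<Longrightarrow> mset_avg W f \<le> mset_avg W g"
  unfolding mset_avg_def by (intro divide_right_mono sum_mset_mono) auto

lemma mset_avg_sum: "mset_avg W (\<lambda>w. \<Sum>j\<in>J. f j w) = (\<Sum>j\<in>J. mset_avg W (f j))"
  unfolding mset_avg_def sum_divide_distrib[symmetric]
  by (simp add: sum_mset_sum_swap[of "\<lambda>w j. f j w"])

lemma mset_avg_add: "mset_avg W (\<lambda>w. f w + g w) = mset_avg W f + mset_avg W g"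
  by (simp add: mset_avg_def sum_mset.distrib add_divide_distrib)

lemma mset_avg_mult: "mset_avg W (\<lambda>w. c * f w) = c * mset_avg W f"
  by (simp only: mset_avg_def sum_mset_distrib_left[symmetric] times_divide_eq_right)

lemma mset_avg_const: "W \<noteq> {#} \<Longrightarrow> mset_avg W (\<lambda>_. c) = c"
  by (simp add: mset_avg_def)

lemma mset_avg_indicator:
  "mset_avg W (\<lambda>w. if P w then 1 else 0) = real (size (filter_mset P W)) / real (size W)"
proof -
  have "(\<Sum>w\<in>#W. if P w then 1 else 0) = real (size (filter_mset P W))"
    by (induction W) auto
  then show ?thesis by (simp add: mset_avg_def)
qed

text \<open>Chebyshev's inequality for the sum of the \<open>X j - q j\<close>, which is at least c
  |J| wherever \<open>P\<close> holds. In the second moment the |J| diagonal terms are at most 1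
  each, and an off-diagonal term is at most 3e: one correlation error and two errors of means, as
  \<open>q j\<close> only approximates the mean of \<open>X j\<close>.\<close>

lemma second_moment_bound:
  fixes X :: "'j \<Rightarrow> 'a \<Rightarrow> real"
  assumes fin: "finite J" "J \<noteq> {}" and W: "W \<noteq> {#}" and c: "0 < c" and e: "0 \<le> e"
    and X: "\<And>j w. j \<in> J \<Longrightarrow> 0 \<le> X j w \<and> X j w \<le> 1"
    and q: "\<And>j. j \<in> J \<Longrightarrow> 0 \<le> q j \<and> q j \<le> 1"
    and mean: "\<And>j. j \<in> J \<Longrightarrow> \<bar>mset_avg W (X j) - q j\<bar> \<le> e"
    and corr: "\<And>i j. i \<in> J \<Longrightarrow> j \<in> J \<Longrightarrow> i \<noteq> j \<Longrightarrow>
      \<bar>mset_avg W (\<lambda>w. X i w * X j w) - q i * q j\<bar> \<le> e"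
    and hit: "\<And>j w. j \<in> J \<Longrightarrow> P w \<Longrightarrow> c \<le> X j w - q j"
  shows "real (size (filter_mset P W)) / real (size W) \<le> (1 / real (card J) + 3 * e) / c\<^sup>2"
proof -
  let ?L = "real (card J)"
  have scale: "a * t \<le> 1 * e" if "0 \<le> a" "a \<le> 1" "\<bar>t\<bar> \<le> e" for a t
  proof -
    have "a * t \<le> a * \<bar>t\<bar>" using that by (intro mult_left_mono) auto
    also have "\<dots> \<le> 1 * e" using that by (intro mult_mono) auto
    finally show ?thesis .
  qed
  have L: "?L > 0" using fin by (simp add: card_gt_0_iff)
  have pair: "mset_avg W (\<lambda>w. (X i w - q i) * (X j w - q j)) \<le> (if i = j then 1 else 0) + 3 * e"
    if ij: "i \<in> J" "j \<in> J" for i j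
  proof (cases "i = j")
    case True
    have "(X i w - q i) * (X j w - q j) \<le> 1" for w
    proof -
      have "\<bar>X i w - q i\<bar> \<le> 1" using X[OF ij(1), of w] q[OF ij(1)] by linarith
      then have "(X i w - q i)\<^sup>2 \<le> 1" by (simp add: abs_square_le_1)
      then show ?thesis using True by (simp add: power2_eq_square)
    qed
    then have "mset_avg W (\<lambda>w. (X i w - q i) * (X j w - q j)) \<le> mset_avg W (\<lambda>_. 1)"
      by (intro mset_avg_mono)
    then show ?thesis using True e W by (simp add: mset_avg_const)
  next
    case False
    have "mset_avg W (\<lambda>w. (X i w - q i) * (X j w - q j)) =
        mset_avg W (\<lambda>w. X i w * X j w + ((- q j) * X i w + ((- q i) * X j w + q i * q j)))"
      by (simp add: algebra_simps)
    also have "\<dots> = mset_avg W (\<lambda>w. X i w * X j w) - q j * mset_avg W (X i) - q i * mset_avg W (X j) + q i * q j"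
      unfolding mset_avg_add mset_avg_mult mset_avg_const[OF W] by simp
    also have "\<dots> = (mset_avg W (\<lambda>w. X i w * X j w) - q i * q j)
        + q j * (q i - mset_avg W (X i)) + q i * (q j - mset_avg W (X j))"
      by (simp add: algebra_simps)
    also have "\<dots> \<le> e + 1 * e + 1 * e"
    proof (intro add_mono)
      show "mset_avg W (\<lambda>w. X i w * X j w) - q i * q j \<le> e" using corr[OF ij False] by simp
      show "q j * (q i - mset_avg W (X i)) \<le> 1 * e"
        using mean[OF ij(1)] q[OF ij(2)]
        by (intro scale) (simp_all add: abs_minus_commute)
      show "q i * (q j - mset_avg W (X j)) \<le> 1 * e"
        using mean[OF ij(2)] q[OF ij(1)]
        by (intro scale) (simp_all add: abs_minus_commute)
    qed
    finally show ?thesis using False by simp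
  qed
  let ?Y = "\<lambda>w. \<Sum>j\<in>J. X j w - q j"
  have "(c * ?L)\<^sup>2 * mset_avg W (\<lambda>w. if P w then 1 else 0) = mset_avg W (\<lambda>w. (c * ?L)\<^sup>2 * (if P w then 1 else 0))"
    by (simp only: mset_avg_mult)
  also have "\<dots> \<le> mset_avg W (\<lambda>w. (?Y w)\<^sup>2)"
  proof (rule mset_avg_mono)
    fix w
    show "(c * ?L)\<^sup>2 * (if P w then 1 else 0) \<le> (?Y w)\<^sup>2"
    proof (cases "P w")
      case True
      have "c * ?L = (\<Sum>j\<in>J. c)" by simp
      also have "\<dots> \<le> ?Y w" using hit[OF _ True] by (rule sum_mono)
      finally have "(c * ?L)\<^sup>2 \<le> (?Y w)\<^sup>2" using c by (intro power_mono) auto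
      then show ?thesis using True by simp
    qed simp
  qed
  also have "\<dots> = (\<Sum>i\<in>J. \<Sum>j\<in>J. mset_avg W (\<lambda>w. (X i w - q i) * (X j w - q j)))"
    by (simp only: power2_eq_square sum_product mset_avg_sum)
  also have "\<dots> \<le> (\<Sum>i\<in>J. \<Sum>j\<in>J. (if i = j then 1 else 0) + 3 * e)"
    by (intro sum_mono pair)
  also have "\<dots> = ?L + ?L\<^sup>2 * (3 * e)"
    using fin by (simp add: sum.distrib power2_eq_square algebra_simps)
  also have "\<dots> = ?L\<^sup>2 * (1 / ?L + 3 * e)"
    using L by (simp add: power2_eq_square field_simps)
  finally have "?L\<^sup>2 * (c\<^sup>2 * mset_avg W (\<lambda>w. if P w then 1 else 0)) \<le> ?L\<^sup>2 * (1 / ?L + 3 * e)"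
    by (simp add: power_mult_distrib mult_ac)
  then have "c\<^sup>2 * mset_avg W (\<lambda>w. if P w then 1 else 0) \<le> 1 / ?L + 3 * e"
    using L by simp
  then show ?thesis
    using c by (simp add: mset_avg_indicator pos_le_divide_eq mult.commute)
qed

subsection \<open>Walks on quotients\<close>

lemma image_mset_sum_mset: "image_mset f (\<Sum>s\<in>#M. F s) = (\<Sum>s\<in>#M. image_mset f (F s))"
  by (induction M) simp_all

lemma symmetric_in_imp_steps_inv:
  assumes "group G" and "symmetric_in G S"
  shows "image_mset (\<lambda>s. inv\<^bsub>G\<^esub> s) S = S"
proof (rule multiset_eqI)
  interpret group G by fact
  have S: "set_mset S \<subseteq> carrier G" and cnt: "\<And>s. s \<in> carrier G \<Longrightarrow> count S s = count S (inv\<^bsub>G\<^esub> s)"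
    using assms(2) unfolding symmetric_in_def by blast+
  fix x
  show "count (image_mset (\<lambda>s. inv\<^bsub>G\<^esub> s) S) x = count S x"
  proof (cases "x \<in> carrier G")
    case True
    have eq: "{y \<in> set_mset S. x = inv\<^bsub>G\<^esub> y} = (if inv\<^bsub>G\<^esub> x \<in># S then {inv\<^bsub>G\<^esub> x} else {})"
      using True S by auto
    have "count (image_mset (\<lambda>s. inv\<^bsub>G\<^esub> s) S) x = (\<Sum>y\<in>{y \<in> set_mset S. x = inv\<^bsub>G\<^esub> y}. count S y)"
      by (simp add: count_image_mset')
    also have "\<dots> = count S (inv\<^bsub>G\<^esub> x)"
      unfolding eq using count_eq_zero_iff[of S "inv\<^bsub>G\<^esub> x"] by (cases "inv\<^bsub>G\<^esub> x \<in># S") auto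
    finally show ?thesis using cnt[OF True] by simp
  next
    case False
    then have "x \<notin># S" and "x \<notin># image_mset (\<lambda>s. inv\<^bsub>G\<^esub> s) S" using S by auto
    then have "count S x = 0" and "count (image_mset (\<lambda>s. inv\<^bsub>G\<^esub> s) S) x = 0"
      by (simp_all only: count_eq_zero_iff not_False_eq_True)
    then show ?thesis by (simp only:)
  qed
qed

text \<open>An empty multiset gives a graph without edges, which is bipartite; so admissibility
  supplies the nonemptiness.\<close>

lemma symmetric_walk_of_admissible:
  assumes "group G" and "admissible G S"
  shows "symmetric_walk G S"
proof -
  interpret group G by fact
  have "S \<noteq> {#}"
  proof
    assume "S = {#}"
    then have "bipartite (carrier G) (cayley_edges G S)"
      unfolding bipartite_def by (intro exI[of _ "carrier G"] exI[of _ "{}"]) (simp add: cayley_edges_def)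
    then show False using assms(2) by (simp add: admissible_def)
  qed
  then show ?thesis
    using assms symmetric_in_imp_steps_inv by unfold_locales (auto simp: admissible_def symmetric_in_def)
qed

context symmetric_walk
begin

abbreviation quotient_steps :: "'a set \<Rightarrow> 'a set multiset" where
  "quotient_steps N \<equiv> image_mset (\<lambda>s. N #> s) S"

lemma quotient_walk:
  assumes "N \<lhd> G" and fin: "finite (carrier (G Mod N))"
  shows "finite_symmetric_walk (G Mod N) (quotient_steps N)"
proof -
  interpret N: normal N G by fact
  interpret Q: group "G Mod N" by (rule N.factorgroup_is_group)
  interpret hom: group_hom G "G Mod N" "\<lambda>x. N #> x"
    by unfold_locales (rule N.r_coset_hom_Mod)
  have "image_mset (\<lambda>s. inv\<^bsub>G Mod N\<^esub> s) (quotient_steps N) = image_mset (\<lambda>s. N #> s) (image_mset (\<lambda>s. inv s) S)"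
    unfolding image_mset.compositionality
    by (intro image_mset_cong) (use steps_closed in \<open>auto simp: hom.hom_inv\<close>)
  then have "image_mset (\<lambda>s. inv\<^bsub>G Mod N\<^esub> s) (quotient_steps N) = quotient_steps N"
    by (simp only: steps_inv)
  then show ?thesis
    using steps_closed steps_nonempty fin by unfold_locales auto
qed

text \<open>The coset map is a homomorphism and is applied word by word. Multiplicities are kept, so
  averages over the walk in the group are averages over the walk in the quotient.\<close>

lemma walk_ends_quotient:
  assumes "N \<lhd> G"
  shows "walk_ends (G Mod N) (quotient_steps N) k = image_mset (\<lambda>x. N #> x) (walk_ends G S k)"
proof (induction k)
  case 0
  interpret N: normal N G by fact
  show ?case using coset_join2[OF one_closed N.subgroup_axioms] N.subset by (simp add: coset_mult_one)
next
  case (Suc k)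
  interpret N: normal N G by fact
  have "image_mset (\<lambda>x. N #> x) (walk_ends G S (Suc k)) =
      (\<Sum>s\<in>#S. image_mset (\<lambda>w. N #> (w \<otimes> s)) (walk_ends G S k))"
    by (simp add: image_mset_sum_mset image_mset.compositionality comp_def)
  also have "\<dots> = (\<Sum>s\<in>#S. image_mset (\<lambda>w. (N #> w) <#> (N #> s)) (walk_ends G S k))"
  proof (intro arg_cong[of _ _ sum_mset] image_mset_cong)
    fix s w assume "s \<in># S" "w \<in># walk_ends G S k"
    then show "N #> (w \<otimes> s) = (N #> w) <#> (N #> s)"
      using steps_closed walk_ends_closed by (subst N.rcos_sum) auto
  qed
  also have "\<dots> = walk_ends (G Mod N) (quotient_steps N) (Suc k)"
    by (simp add: Suc image_mset.compositionality comp_def)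
  finally show ?case by simp
qed

text \<open>The closed walk of length \<open>n\<close> in the group projects to a closed walk of the
  same length, so \<rho> is the same for every \<open>N\<close>.\<close>

lemma quotient_equidistribution:
  assumes "N \<lhd> G" and "0 < \<epsilon>"
    and exp: "expander \<epsilon> (carrier (G Mod N)) (cayley_edges (G Mod N) (quotient_steps N)) (size S)"
    and "\<one> \<in># walk_ends G S n" and "odd n"
    and \<rho>: "\<rho> = max (1 / 2) (max (1 - \<epsilon>) (1 - 2 / ((real n)\<^sup>2 * real (size S))))"
    and h: "\<And>x. x \<in> carrier (G Mod N) \<Longrightarrow> \<bar>h x\<bar> \<le> 1"
  shows "\<bar>mset_avg (walk_ends G S k) (\<lambda>w. h (N #> w)) -
      (\<Sum>x\<in>carrier (G Mod N). h x) / real (card (carrier (G Mod N)))\<bar>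
    \<le> real (card (carrier (G Mod N))) * \<rho> ^ k"
proof -
  interpret N: normal N G by fact
  have fin: "finite (carrier (G Mod N))" using exp by (simp add: expander_def)
  interpret Q: finite_symmetric_walk "G Mod N" "quotient_steps N"
    by (rule quotient_walk[OF assms(1) fin])
  have "N #> \<one> \<in># walk_ends (G Mod N) (quotient_steps N) n"
    unfolding walk_ends_quotient[OF assms(1)] using assms(4) by auto
  then have one: "\<one>\<^bsub>G Mod N\<^esub> \<in># walk_ends (G Mod N) (quotient_steps N) n"
    using N.subset by (simp add: coset_mult_one)
  show ?thesis
    using Q.equidistribution_of_expander[OF assms(2) _ one assms(5) _ h, where \<rho> = \<rho> and k = k] exp \<rho>
    by (simp add: walk_ends_quotient[OF assms(1)] image_mset.compositionality comp_def
        mset_avg_def size_walk_ends)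
qed

end

section \<open>Independence of property tau from the generating multiset\<close>

context symmetric_walk
begin

lemma expander_family_transfer:
  assumes gen: "generates G S" and tau: "property_tau G \<N>" and normal: "\<And>N. N \<in> \<N> \<Longrightarrow> N \<lhd> G"
  shows "\<exists>\<epsilon>>0. cayley_expander_family G S \<N> \<epsilon>"
proof -
  obtain T \<epsilon> where T: "symmetric_in G T" "generates G T" and \<epsilon>: "0 < \<epsilon>"
    and fam: "cayley_expander_family G T \<N> \<epsilon>"
    using tau by (auto simp: property_tau_def)
  show ?thesis
  \<comment> \<open>An empty generating multiset makes the group trivial. Every quotient then has
    one vertex, and any constant will do.\<close>
  proof (cases "T = {#}")
    case True
    have "carrier G = {\<one>}"
      using T(2) True generate_empty by (simp add: generates_def)
    then have "carrier (G Mod N) = {N #> \<one>}" for N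
      by (simp add: carrier_FactGroup)
    then have "cayley_expander_family G S \<N> 1"
      by (simp add: cayley_expander_family_def expander_def)
    then show ?thesis by (intro exI[of _ 1]) simp
  next
    case False
    interpret T: symmetric_walk G T
      using T(1) False symmetric_in_imp_steps_inv[OF is_group T(1)]
      by unfold_locales (simp_all add: symmetric_in_def)
    have "\<exists>n. t \<in># walk_ends G S n" if "t \<in># T" for t
      using reachable[OF gen] that T.steps_closed by blast
    then obtain len where len: "\<And>t. t \<in># T \<Longrightarrow> t \<in># walk_ends G S (len t)" by metis
    \<comment> \<open>A common bound for the word lengths, taken in the group and hence valid in
      every quotient; the successor makes it positive.\<close>
    define L where "L = Suc (\<Sum>t\<in>set_mset T. len t)"
    have len_le: "len t \<le> L" if "t \<in># T" for t
      using member_le_sum[of t "set_mset T" len] that by (simp add: L_def)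
    have L: "0 < L" by (simp add: L_def)
    have "cayley_expander_family G S \<N> (\<epsilon> / ((real L)\<^sup>2 * real (size S)))"
      unfolding cayley_expander_family_def
    proof
      fix N assume N: "N \<in> \<N>"
      have exp: "expander \<epsilon> (carrier (G Mod N)) (cayley_edges (G Mod N) (T.quotient_steps N)) (size T)"
        using fam N by (simp add: cayley_expander_family_def)
      then have fin: "finite (carrier (G Mod N))" by (simp add: expander_def)
      interpret Q: finite_symmetric_walk "G Mod N" "quotient_steps N"
        by (rule quotient_walk[OF normal[OF N] fin])
      have "expander (\<epsilon> / ((real L)\<^sup>2 * real (size (quotient_steps N)))) (carrier (G Mod N))
          (cayley_edges (G Mod N) (quotient_steps N)) (size (quotient_steps N))"
      proof (rule Q.expander_compare[OF T.quotient_walk[OF normal[OF N] fin] \<epsilon> L])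
        show "expander \<epsilon> (carrier (G Mod N)) (cayley_edges (G Mod N) (T.quotient_steps N)) (size (T.quotient_steps N))"
          using exp by simp
        show "\<exists>n\<le>L. t \<in># walk_ends (G Mod N) (quotient_steps N) n" if "t \<in># T.quotient_steps N" for t
          unfolding walk_ends_quotient[OF normal[OF N]] using that len len_le by auto
      qed
      then show "expander (\<epsilon> / ((real L)\<^sup>2 * real (size S))) (carrier (G Mod N))
          (cayley_edges (G Mod N) (quotient_steps N)) (size S)"
        by simp
    qed
    moreover have "0 < \<epsilon> / ((real L)\<^sup>2 * real (size S))"
      using \<epsilon> L size_pos by simp
    ultimately show ?thesis by blast
  qed
qed

end

section \<open>Intersections of two normal subgroups\<close>

lemma (in group) normal_Int:
  assumes "H \<lhd> G" "K \<lhd> G"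
  shows "H \<inter> K \<lhd> G"
  using assms by (auto simp: normal_inv_iff intro: subgroups_Inter_pair)

lemma (in group) r_coset_eq_iff:
  assumes "subgroup H G" "x \<in> carrier G" "y \<in> carrier G"
  shows "H #> x = H #> y \<longleftrightarrow> y \<in> H #> x"
  using assms repr_independence repr_independenceD by metis

lemma (in group) r_coset_Int_eq_iff:
  assumes "subgroup H G" "subgroup K G" "x \<in> carrier G" "y \<in> carrier G"
  shows "(H \<inter> K) #> x = (H \<inter> K) #> y \<longleftrightarrow> H #> x = H #> y \<and> K #> x = K #> y"
proof -
  have "y \<in> (H \<inter> K) #> x \<longleftrightarrow> y \<in> H #> x \<and> y \<in> K #> x"
  proof
    assume "y \<in> H #> x \<and> y \<in> K #> x"
    then obtain h k where hk: "h \<in> H" "y = h \<otimes> x" "k \<in> K" "y = k \<otimes> x"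
      by (auto simp: r_coset_def)
    then have "h = k"
      using assms by (metis right_cancel subgroup.mem_carrier)
    then show "y \<in> (H \<inter> K) #> x" using hk by (auto simp: r_coset_def)
  qed (auto simp: r_coset_def)
  then show ?thesis
    using assms by (simp add: r_coset_eq_iff subgroups_Inter_pair)
qed

text \<open>Sending the coset of x to the pair of its cosets modulo \<open>H\<close> and
  \<open>K\<close> is injective, and the index condition makes it bijective by counting. So a
  uniform coset modulo the intersection has independent uniform components, and a sum of products
  factors.\<close>

lemma (in group) sum_quotient_Int:
  fixes f g :: "'a set \<Rightarrow> real"
  assumes normal: "H \<lhd> G" "K \<lhd> G"
    and fin: "finite (carrier (G Mod H))" "finite (carrier (G Mod K))"
    and card: "card (carrier (G Mod (H \<inter> K))) = card (carrier (G Mod H)) * card (carrier (G Mod K))"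
  obtains F where "\<And>x. x \<in> carrier G \<Longrightarrow> F ((H \<inter> K) #> x) = f (H #> x) * g (K #> x)"
    and "(\<Sum>C\<in>carrier (G Mod (H \<inter> K)). F C) = (\<Sum>A\<in>carrier (G Mod H). f A) * (\<Sum>B\<in>carrier (G Mod K). g B)"
proof -
  interpret H: normal H G by fact
  interpret K: normal K G by fact
  note coset_eq = r_coset_Int_eq_iff[OF H.subgroup_axioms K.subgroup_axioms]
  define rep where "rep C = (SOME x. x \<in> carrier G \<and> C = (H \<inter> K) #> x)" for C
  have rep: "rep C \<in> carrier G \<and> C = (H \<inter> K) #> rep C" if C: "C \<in> carrier (G Mod (H \<inter> K))" for C
  proof -
    obtain x where "x \<in> carrier G \<and> C = (H \<inter> K) #> x"
      using C unfolding carrier_FactGroup by blast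
    then show ?thesis
      unfolding rep_def by (rule someI[of "\<lambda>x. x \<in> carrier G \<and> C = (H \<inter> K) #> x"])
  qed
  define \<phi> where "\<phi> C = (H #> rep C, K #> rep C)" for C
  have \<phi>: "\<phi> ((H \<inter> K) #> x) = (H #> x, K #> x)" if "x \<in> carrier G" for x
  proof -
    have "rep ((H \<inter> K) #> x) \<in> carrier G \<and> (H \<inter> K) #> x = (H \<inter> K) #> rep ((H \<inter> K) #> x)"
      using that by (intro rep) (simp add: carrier_FactGroup)
    then show ?thesis
      using coset_eq[of x "rep ((H \<inter> K) #> x)"] that by (metis \<phi>_def)
  qed
  have inj: "inj_on \<phi> (carrier (G Mod (H \<inter> K)))"
  proof (rule inj_onI)
    fix C D
    assume "C \<in> carrier (G Mod (H \<inter> K))" "D \<in> carrier (G Mod (H \<inter> K))" "\<phi> C = \<phi> D"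
    then obtain x y where "x \<in> carrier G" "y \<in> carrier G" "C = (H \<inter> K) #> x" "D = (H \<inter> K) #> y"
      and "\<phi> C = \<phi> D"
      unfolding carrier_FactGroup by blast
    then show "C = D" using \<phi>[of x] \<phi>[of y] coset_eq[of x y] by simp
  qed
  have "\<phi> ` carrier (G Mod (H \<inter> K)) = carrier (G Mod H) \<times> carrier (G Mod K)"
  proof (rule card_subset_eq)
    show "\<phi> ` carrier (G Mod (H \<inter> K)) \<subseteq> carrier (G Mod H) \<times> carrier (G Mod K)"
      by (auto simp: carrier_FactGroup \<phi>)
  qed (use fin card inj in \<open>simp_all add: card_image card_cartesian_product\<close>)
  then have bij: "bij_betw \<phi> (carrier (G Mod (H \<inter> K))) (carrier (G Mod H) \<times> carrier (G Mod K))"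
    using inj by (simp add: bij_betw_def)
  let ?F = "\<lambda>C. f (fst (\<phi> C)) * g (snd (\<phi> C))"
  have "(\<Sum>C\<in>carrier (G Mod (H \<inter> K)). ?F C) =
      (\<Sum>(A, B)\<in>carrier (G Mod H) \<times> carrier (G Mod K). f A * g B)"
    by (subst sum.reindex_bij_betw[OF bij, symmetric]) (simp add: case_prod_unfold)
  also have "\<dots> = (\<Sum>A\<in>carrier (G Mod H). f A) * (\<Sum>B\<in>carrier (G Mod K). g B)"
    by (simp add: sum_product sum.cartesian_product)
  finally show ?thesis by (rule that[rotated]) (simp add: \<phi>)
qed

subsection \<open>The sieve\<close>

context symmetric_walk
begin

text \<open>The level \<open>L\<close> is kept free here: more indices lower the variance term but
  enlarge the quotients that have to be equidistributed. It is chosen later as a function of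
  \<open>k\<close>.\<close>

lemma walk_prob_sieve:
  fixes N :: "nat \<Rightarrow> 'a set" and Z :: "'a set" and c d :: real
  assumes normal: "\<And>j. 2 \<le> j \<Longrightarrow> N j \<lhd> G" and fin: "\<And>j. 2 \<le> j \<Longrightarrow> finite (carrier (G Mod N j))"
    and Z: "Z \<subseteq> carrier G"
    and growth: "\<And>j. 2 \<le> j \<Longrightarrow> real (card (carrier (G Mod N j))) \<le> real j powr d" and d: "0 \<le> d"
    and indep: "\<And>i j. 2 \<le> i \<Longrightarrow> 2 \<le> j \<Longrightarrow> i \<noteq> j \<Longrightarrow>
      card (carrier (G Mod (N i \<inter> N j))) = card (carrier (G Mod N i)) * card (carrier (G Mod N j))"
    and c: "0 < c"
    and small: "\<And>j. 2 \<le> j \<Longrightarrow> real (card ((\<lambda>z. N j #> z) ` Z)) \<le> (1 - c) * real (card (carrier (G Mod N j)))"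
    and \<epsilon>: "0 < \<epsilon>" and fam: "cayley_expander_family G S {N i \<inter> N j | i j. 2 \<le> i \<and> 2 \<le> j} \<epsilon>"
    and n: "\<one> \<in># walk_ends G S n" "odd n"
    and \<rho>: "\<rho> = max (1 / 2) (max (1 - \<epsilon>) (1 - 2 / ((real n)\<^sup>2 * real (size S))))"
    and L: "0 < L"
  shows "walk_prob G S k Z \<le> (1 / real L + 3 * (real (L + 1) powr (2 * d) * \<rho> ^ k)) / c\<^sup>2"
proof -
  let ?W = "walk_ends G S k"
  \<comment> \<open>Exactly \<open>L\<close> indices, the largest being \<open>L + 1\<close>; hence
    the base \<open>L + 1\<close> below.\<close>
  define J where "J = {2..<L + 2}"
  define Y where "Y j = (\<lambda>z. N j #> z) ` Z" for j
  define Q where "Q j = carrier (G Mod N j)" for j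
  define h :: "nat \<Rightarrow> 'a set \<Rightarrow> real" where "h j A = (if A \<in> Y j then 1 else 0)" for j A
  define q where "q j = (\<Sum>A\<in>Q j. h j A) / real (card (Q j))" for j
  define e where "e = real (L + 1) powr (2 * d) * \<rho> ^ k"
  have h01: "0 \<le> h j A \<and> h j A \<le> 1" for j A by (simp add: h_def)
  have \<rho>0: "0 < \<rho>" by (simp add: \<rho>)
  have Qcard: "0 < card (Q j)" if "2 \<le> j" for j
    using fin[OF that] by (auto simp: Q_def card_gt_0_iff carrier_FactGroup)
  have Qbound: "real (card (Q j)) \<le> real (L + 1) powr d" if "j \<in> J" for j
  proof -
    have "real (card (Q j)) \<le> real j powr d" using growth that by (simp add: J_def Q_def)
    also have "\<dots> \<le> real (L + 1) powr d" using that d by (intro powr_mono2) (auto simp: J_def)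
    finally show ?thesis .
  qed
  have sum_h: "(\<Sum>A\<in>Q j. h j A) = real (card (Y j))" if "2 \<le> j" for j
  proof -
    have "Y j \<subseteq> Q j" using Z by (auto simp: Y_def Q_def carrier_FactGroup)
    then show ?thesis
      using fin[OF that] by (simp add: h_def Q_def sum.If_cases Int_absorb1)
  qed
  have q: "0 \<le> q j \<and> q j \<le> 1 \<and> q j \<le> 1 - c" if "2 \<le> j" for j
  proof -
    have "q j \<le> 1 - c"
      using small[OF that] Qcard[OF that] unfolding q_def sum_h[OF that]
      by (simp add: Y_def Q_def pos_divide_le_eq)
    moreover have "0 \<le> q j" unfolding q_def by (intro divide_nonneg_nonneg sum_nonneg) (simp_all add: h01)
    ultimately show ?thesis using c by simp
  qed
  have exp: "expander \<epsilon> (carrier (G Mod (N i \<inter> N j))) (cayley_edges (G Mod (N i \<inter> N j)) (quotient_steps (N i \<inter> N j))) (size S)"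
    if "2 \<le> i" "2 \<le> j" for i j
    using fam that unfolding cayley_expander_family_def by blast
  have mean: "\<bar>mset_avg ?W (\<lambda>w. h j (N j #> w)) - q j\<bar> \<le> e" if j: "j \<in> J" for j
  proof -
    have j2: "2 \<le> j" using j by (simp add: J_def)
    \<comment> \<open>The member \<open>N j \<inter> N j\<close> of the family is
      \<open>N j\<close>.\<close>
    have "\<bar>mset_avg ?W (\<lambda>w. h j (N j #> w)) - q j\<bar> \<le> real (card (Q j)) * \<rho> ^ k"
      unfolding q_def Q_def
      using quotient_equidistribution[OF normal[OF j2] \<epsilon> _ n \<rho>, where h = "h j" and k = k] exp[OF j2 j2] h01
      by simp
    also have "\<dots> \<le> real (L + 1) powr (2 * d) * \<rho> ^ k"
    proof (rule mult_right_mono)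
      have "real (card (Q j)) \<le> real (L + 1) powr d" by (rule Qbound[OF j])
      also have "\<dots> \<le> real (L + 1) powr (2 * d)" using d by (intro powr_mono) auto
      finally show "real (card (Q j)) \<le> real (L + 1) powr (2 * d)" .
    qed (use \<rho>0 in simp)
    finally show ?thesis by (simp add: e_def)
  qed
  have corr: "\<bar>mset_avg ?W (\<lambda>w. h i (N i #> w) * h j (N j #> w)) - q i * q j\<bar> \<le> e"
    if i: "i \<in> J" and j: "j \<in> J" and "i \<noteq> j" for i j
  proof -
    have i2: "2 \<le> i" and j2: "2 \<le> j" using i j by (simp_all add: J_def)
    note card_Int = indep[OF i2 j2 \<open>i \<noteq> j\<close>]
    obtain F where F: "\<And>x. x \<in> carrier G \<Longrightarrow> F ((N i \<inter> N j) #> x) = h i (N i #> x) * h j (N j #> x)"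
      and sumF: "(\<Sum>C\<in>carrier (G Mod (N i \<inter> N j)). F C) = (\<Sum>A\<in>Q i. h i A) * (\<Sum>B\<in>Q j. h j B)"
      using sum_quotient_Int[OF normal[OF i2] normal[OF j2] fin[OF i2] fin[OF j2] card_Int, of "h i" "h j"]
      unfolding Q_def by metis
    have F1: "\<bar>F C\<bar> \<le> 1" if "C \<in> carrier (G Mod (N i \<inter> N j))" for C
      using that F by (auto simp: carrier_FactGroup h_def)
    have "mset_avg ?W (\<lambda>w. h i (N i #> w) * h j (N j #> w)) = mset_avg ?W (\<lambda>w. F ((N i \<inter> N j) #> w))"
      by (intro mset_avg_cong) (simp add: F walk_ends_closed)
    moreover have "q i * q j = (\<Sum>C\<in>carrier (G Mod (N i \<inter> N j)). F C) / real (card (carrier (G Mod (N i \<inter> N j))))"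
      unfolding sumF card_Int q_def by (simp add: Q_def)
    ultimately have "\<bar>mset_avg ?W (\<lambda>w. h i (N i #> w) * h j (N j #> w)) - q i * q j\<bar>
        \<le> real (card (carrier (G Mod (N i \<inter> N j)))) * \<rho> ^ k"
      using quotient_equidistribution[OF normal_Int[OF normal[OF i2] normal[OF j2]] \<epsilon> exp[OF i2 j2] n \<rho> F1, where k = k]
      by simp
    also have "\<dots> \<le> real (L + 1) powr (2 * d) * \<rho> ^ k"
    proof (rule mult_right_mono)
      have "real (card (Q i)) * real (card (Q j)) \<le> real (L + 1) powr d * real (L + 1) powr d"
        using Qbound[OF i] Qbound[OF j] by (intro mult_mono) auto
      also have "\<dots> = real (L + 1) powr (2 * d)" by (simp flip: powr_add)
      finally show "real (card (carrier (G Mod (N i \<inter> N j)))) \<le> real (L + 1) powr (2 * d)"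
        by (simp add: card_Int Q_def)
    qed (use \<rho>0 in simp)
    finally show ?thesis by (simp add: e_def)
  qed
  have W: "?W \<noteq> {#}"
    using size_pos by (metis nonempty_has_size size_walk_ends zero_less_power)
  have "real (size (filter_mset (\<lambda>w. w \<in> Z) ?W)) / real (size ?W) \<le> (1 / real (card J) + 3 * e) / c\<^sup>2"
  proof (rule second_moment_bound[where X = "\<lambda>j w. h j (N j #> w)" and q = q])
    \<comment> \<open>For w in \<open>Z\<close> the coset lies in \<open>Y j\<close>, so
      \<open>h\<close> is 1, while \<open>q j\<close> is at most 1 - c.\<close>
    show "c \<le> h j (N j #> w) - q j" if "j \<in> J" "w \<in> Z" for j w
      using that q[of j] by (auto simp: h_def Y_def J_def)
  qed (use W c \<rho>0 h01 q mean corr L in \<open>auto simp: e_def J_def\<close>)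
  then show ?thesis
    by (simp add: walk_prob_def size_walk_ends e_def J_def)
qed

end

text \<open>\<open>L = \<lceil>exp (\<eta> k)\<rceil>\<close>, where \<open>\<eta> (2 d + 1) = - ln \<rho>\<close> balances the two summands.\<close>

lemma sieve_level_choice:
  fixes \<rho> d :: real
  assumes \<rho>: "0 < \<rho>" "\<rho> < 1" and d: "0 \<le> d"
  shows "\<exists>L>0. 1 / real L + 3 * (real (L + 1) powr (2 * d) * \<rho> ^ k) \<le>
    (1 + 3 * 9 powr d) * exp (- (- ln \<rho> / (2 * d + 1)) * real k)"
proof -
  define \<eta> where "\<eta> = - ln \<rho> / (2 * d + 1)"
  have \<eta>: "0 \<le> \<eta>"
    unfolding \<eta>_def using \<rho> d by (intro divide_nonneg_nonneg) (simp_all add: ln_le_zero_iff)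
  define E where "E = exp (\<eta> * real k)"
  have E: "1 \<le> E" using \<eta> by (simp add: E_def)
  define L where "L = nat \<lceil>E\<rceil>"
  have L: "E \<le> real L" "real L \<le> E + 1" "0 < L"
    using E unfolding L_def by linarith+
  have "1 / real L \<le> 1 / E" using E L by (intro divide_left_mono) auto
  moreover have "real (L + 1) powr (2 * d) * \<rho> ^ k \<le> 9 powr d * (1 / E)"
  proof -
    \<comment> \<open>In terms of \<open>E\<close> this is E^-(2d+1). Against E^(2d) from the size
      of the quotients it leaves 1/E, the order of the variance term.\<close>
    have \<rho>_pow: "\<rho> ^ k = exp (- (2 * d + 1) * \<eta> * real k)"
    proof -
      have "(2 * d + 1) * \<eta> = - ln \<rho>" using d by (simp add: \<eta>_def)
      then have "- (2 * d + 1) * \<eta> = ln \<rho>" unfolding mult_minus_left by simp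
      then have "exp (- (2 * d + 1) * \<eta> * real k) = exp (ln \<rho> * real k)" by (simp only:)
      also have "\<dots> = \<rho> ^ k" using \<rho> by (simp add: exp_of_nat2_mult)
      finally show ?thesis by simp
    qed
    \<comment> \<open>Rounding up gives L + 1 \<le> E + 2 \<le> 3E as E is at least 1; 3^(2d) is the
      9^d of the constant.\<close>
    have "real (L + 1) powr (2 * d) \<le> (3 * E) powr (2 * d)"
      using E L d by (intro powr_mono2) auto
    also have "\<dots> = 9 powr d * E powr (2 * d)"
    proof -
      have "(3 :: real) powr 2 = 9" by simp
      then have "(3 :: real) powr (2 * d) = 9 powr d" by (metis powr_powr)
      then show ?thesis using E by (simp add: powr_mult)
    qed
    also have "E powr (2 * d) = exp (2 * d * \<eta> * real k)"
      by (simp add: E_def powr_def mult_ac)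
    finally have "real (L + 1) powr (2 * d) * \<rho> ^ k \<le> 9 powr d * exp (2 * d * \<eta> * real k) * \<rho> ^ k"
      using \<rho> by (intro mult_right_mono) auto
    also have "\<dots> = 9 powr d * (1 / E)"
      unfolding \<rho>_pow
      by (simp add: E_def exp_minus[symmetric] inverse_eq_divide[symmetric] mult.assoc flip: exp_add)
        (simp add: algebra_simps)
    finally show ?thesis .
  qed
  ultimately have "1 / real L + 3 * (real (L + 1) powr (2 * d) * \<rho> ^ k) \<le> (1 + 3 * 9 powr d) * (1 / E)"
    by (simp add: algebra_simps)
  also have "1 / E = exp (- \<eta> * real k)" by (simp add: E_def exp_minus inverse_eq_divide)
  finally show ?thesis using L(3) by (auto simp: \<eta>_def)
qed

section \<open>Explicit constants and conclusion\<close>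

definition decay_rho :: "nat \<Rightarrow> nat \<Rightarrow> real \<Rightarrow> real" where
  "decay_rho n D \<epsilon> = max (1 / 2) (max (1 - \<epsilon>) (1 - 2 / ((real n)\<^sup>2 * real D)))"

text \<open>The constants are functions of the walk data and the parameters alone, so that they can
  be exhibited before any family of subgroups. The exponent is replaced by \<open>max d 0\<close>
  since d ranges over all reals, while the estimates use monotonicity for nonnegative
  exponents.\<close>

definition decay_rate :: "nat \<Rightarrow> nat \<Rightarrow> real \<Rightarrow> real \<Rightarrow> real" where
  "decay_rate n D \<epsilon> d = - ln (decay_rho n D \<epsilon>) / (2 * max d 0 + 1)"

definition decay_factor :: "real \<Rightarrow> real \<Rightarrow> real" where
  "decay_factor c d = (1 + 3 * 9 powr max d 0) / c\<^sup>2"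

lemma decay_rho_bounds:
  assumes "0 < n" "0 < D" "0 < \<epsilon>"
  shows "0 < decay_rho n D \<epsilon>" "decay_rho n D \<epsilon> < 1"
  using assms by (auto simp: decay_rho_def)

lemma decay_rate_pos:
  assumes "0 < n" "0 < D" "0 < \<epsilon>"
  shows "0 < decay_rate n D \<epsilon> d"
proof -
  have "ln (decay_rho n D \<epsilon>) < 0" using decay_rho_bounds[OF assms] by (simp add: ln_less_zero)
  then show ?thesis unfolding decay_rate_def by (intro divide_pos_pos) auto
qed

lemma decay_factor_pos: "0 < c \<Longrightarrow> 0 < decay_factor c d"
  by (simp add: decay_factor_def add_pos_nonneg)

text \<open>Property tau is left out of this bundle: the estimates use an expansion constant for the
  multiset at hand, which varies with the multiset.\<close>

definition sieve_conditions ::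
    "('a, 'b) monoid_scheme \<Rightarrow> (nat \<Rightarrow> 'a set) \<Rightarrow> 'a set \<Rightarrow> real \<Rightarrow> real \<Rightarrow> bool" where
  "sieve_conditions G N Z c d \<longleftrightarrow>
     (\<forall>j\<ge>2. N j \<lhd> G \<and> finite (carrier (G Mod N j))) \<and>
     Z \<subseteq> carrier G \<and>
     (\<forall>j\<ge>2. real (card (carrier (G Mod N j))) \<le> real j powr d) \<and>
     (\<forall>i\<ge>2. \<forall>j\<ge>2. i \<noteq> j \<longrightarrow>
        card (carrier (G Mod (N i \<inter> N j))) =
          card (carrier (G Mod N i)) * card (carrier (G Mod N j))) \<and>
     0 < c \<and>
     (\<forall>j\<ge>2. real (card ((\<lambda>z. N j #>\<^bsub>G\<^esub> z) ` Z)) \<le>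
        (1 - c) * real (card (carrier (G Mod N j))))"

lemma (in group) sieve_conditions_normal:
  assumes sieve: "sieve_conditions G N Z c d"
    and M: "M \<in> {N i \<inter> N j | i j. 2 \<le> i \<and> 2 \<le> j}"
  shows "M \<lhd> G"
proof -
  obtain i j where "M = N i \<inter> N j" "2 \<le> i" "2 \<le> j" using M by blast
  moreover have "N i \<lhd> G" if "2 \<le> i" for i
    using sieve that unfolding sieve_conditions_def by blast
  ultimately show ?thesis by (simp add: normal_Int)
qed

lemma (in symmetric_walk) walk_prob_exponential_decay:
  assumes sieve: "sieve_conditions G N Z c d"
    and \<epsilon>: "0 < \<epsilon>" and fam: "cayley_expander_family G S {N i \<inter> N j | i j. 2 \<le> i \<and> 2 \<le> j} \<epsilon>"
    and n: "\<one> \<in># walk_ends G S n" "odd n"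
  shows "walk_prob G S k Z \<le> decay_factor c d * exp (- decay_rate n (size S) \<epsilon> d * real k)"
proof -
  let ?\<rho> = "decay_rho n (size S) \<epsilon>" and ?d = "max d 0"
  have c: "0 < c" using sieve by (simp add: sieve_conditions_def)
  have "0 < n" using n(2) by (rule odd_pos)
  note \<rho> = decay_rho_bounds[OF this size_pos \<epsilon>]
  obtain L where L: "L > 0" and choice: "1 / real L + 3 * (real (L + 1) powr (2 * ?d) * ?\<rho> ^ k) \<le>
      (1 + 3 * 9 powr ?d) * exp (- decay_rate n (size S) \<epsilon> d * real k)"
    using sieve_level_choice[OF \<rho>, of ?d k] by (auto simp: decay_rate_def)
  have growth: "real (card (carrier (G Mod N j))) \<le> real j powr ?d" if "2 \<le> j" for j
  proof -
    have "real (card (carrier (G Mod N j))) \<le> real j powr d" using sieve that by (simp add: sieve_conditions_def)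
    also have "\<dots> \<le> real j powr ?d" using that by (intro powr_mono) auto
    finally show ?thesis .
  qed
  have "walk_prob G S k Z \<le> (1 / real L + 3 * (real (L + 1) powr (2 * ?d) * ?\<rho> ^ k)) / c\<^sup>2"
  proof (rule walk_prob_sieve[OF _ _ _ growth _ _ c _ \<epsilon> fam n decay_rho_def L])
    show "N j \<lhd> G" "finite (carrier (G Mod N j))"
      "real (card ((\<lambda>z. N j #> z) ` Z)) \<le> (1 - c) * real (card (carrier (G Mod N j)))" if "2 \<le> j" for j
      using sieve that unfolding sieve_conditions_def by blast+
    show "card (carrier (G Mod (N i \<inter> N j))) = card (carrier (G Mod N i)) * card (carrier (G Mod N j))"
      if "2 \<le> i" "2 \<le> j" "i \<noteq> j" for i j
      using sieve that unfolding sieve_conditions_def by blast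
    show "Z \<subseteq> carrier G" using sieve unfolding sieve_conditions_def by blast
  qed simp_all
  also have "\<dots> \<le> ((1 + 3 * 9 powr ?d) * exp (- decay_rate n (size S) \<epsilon> d * real k)) / c\<^sup>2"
    using choice by (rule divide_right_mono) simp
  finally show ?thesis by (simp add: decay_factor_def)
qed

text \<open>Every admissible generating multiset has its own expansion constant, by transfer, and
  its own odd closed walk; the resulting rate may depend on it.\<close>

lemma exponentially_small_of_sieve:
  assumes G: "group G" and sieve: "sieve_conditions G N Z c d"
    and tau: "property_tau G {N i \<inter> N j | i j. 2 \<le> i \<and> 2 \<le> j}"
  shows "exponentially_small G Z"
  unfolding exponentially_small_def
proof (intro allI impI)
  fix S assume S: "admissible G S \<and> generates G S"
  then interpret symmetric_walk G S using G symmetric_walk_of_admissible by blast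
  obtain \<epsilon> where \<epsilon>: "0 < \<epsilon>" and fam: "cayley_expander_family G S {N i \<inter> N j | i j. 2 \<le> i \<and> 2 \<le> j} \<epsilon>"
    using expander_family_transfer[OF conjunct2[OF S] tau sieve_conditions_normal[OF sieve]] by blast
  obtain n where n: "odd n" "\<one>\<^bsub>G\<^esub> \<in># walk_ends G S n"
    using odd_closed_walk S by (auto simp: admissible_def)
  have "0 < decay_rate n (size S) \<epsilon> d" using odd_pos[OF n(1)] size_pos \<epsilon> by (rule decay_rate_pos)
  moreover have "0 < decay_factor c d" using sieve by (simp add: sieve_conditions_def decay_factor_pos)
  ultimately show "exponentially_small_wrt G S Z"
    unfolding exponentially_small_wrt_def
    by (intro exI[of _ "decay_factor c d"] exI[of _ "decay_rate n (size S) \<epsilon> d"] conjI allI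
        walk_prob_exponential_decay[OF sieve \<epsilon> fam n(2,1)])
qed

text \<open>Growth enters through the exponent d. The strength of property tau enters through an
  expansion constant \<epsilon> of the family with respect to the given generators: \<gamma> and
  \<open>r\<close> are functions of \<epsilon>, c and d fixed before the subgroups and
  \<open>Z\<close>, and the first conclusion provides some such \<epsilon>.\<close>

theorem theoremB:
  fixes G :: "('a, 'b) monoid_scheme" and S :: "'a set"
  assumes "group G"
    and "finite S"
    and "symmetric_in G (mset_set S)"
    and "generates G (mset_set S)"
    and "\<not> bipartite (carrier G) (cayley_edges G (mset_set S))"
  shows "\<exists>\<gamma> r :: real \<Rightarrow> real \<Rightarrow> real \<Rightarrow> real.
    (\<forall>\<epsilon> c d. 0 < \<epsilon> \<and> 0 < c \<longrightarrow> 0 < \<gamma> \<epsilon> c d \<and> 0 < r \<epsilon> c d) \<and>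
    (\<forall>(N :: nat \<Rightarrow> 'a set) (Z :: 'a set) (c :: real) (d :: real).
       (\<forall>j\<ge>2. N j \<lhd> G \<and> finite (carrier (G Mod N j))) \<and>
       Z \<subseteq> carrier G \<and>
       property_tau G {N i \<inter> N j | i j. 2 \<le> i \<and> 2 \<le> j} \<and>
       (\<forall>j\<ge>2. real (card (carrier (G Mod N j))) \<le> real j powr d) \<and>
       (\<forall>i\<ge>2. \<forall>j\<ge>2. i \<noteq> j \<longrightarrow>
          card (carrier (G Mod (N i \<inter> N j))) =
            card (carrier (G Mod N i)) * card (carrier (G Mod N j))) \<and>
       0 < c \<and>
       (\<forall>j\<ge>2. real (card ((\<lambda>z. N j #>\<^bsub>G\<^esub> z) ` Z)) \<le>
          (1 - c) * real (card (carrier (G Mod N j))))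
       \<longrightarrow>
       (\<exists>\<epsilon>>0. cayley_expander_family G (mset_set S) {N i \<inter> N j | i j. 2 \<le> i \<and> 2 \<le> j} \<epsilon>) \<and>
       (\<forall>\<epsilon>>0. cayley_expander_family G (mset_set S) {N i \<inter> N j | i j. 2 \<le> i \<and> 2 \<le> j} \<epsilon> \<longrightarrow>
          (\<forall>k::nat. r \<epsilon> c d \<le> real k \<longrightarrow>
             walk_prob G (mset_set S) k Z \<le> exp (- \<gamma> \<epsilon> c d * real k))) \<and>
       exponentially_small G Z)"
proof -
  let ?S = "mset_set S"
  interpret symmetric_walk G ?S
    using assms by (intro symmetric_walk_of_admissible) (simp_all add: admissible_def)
  obtain n where n: "odd n" "\<one>\<^bsub>G\<^esub> \<in># walk_ends G ?S n"
    using odd_closed_walk assms by blast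
  define \<eta> where "\<eta> \<epsilon> d = decay_rate n (size ?S) \<epsilon> d" for \<epsilon> d
  \<comment> \<open>Half of the decay rate is given up to absorb \<open>decay_factor\<close>, which
    is at most exp(\<eta> k / 2) once k reaches \<open>r\<close>. The 1 in \<open>r\<close> keeps it
    positive when the logarithm is not.\<close>
  define \<gamma> where "\<gamma> \<epsilon> (c :: real) d = \<eta> \<epsilon> d / 2" for \<epsilon> c d
  define r where "r \<epsilon> c d = max 1 (2 * ln (decay_factor c d) / \<eta> \<epsilon> d)" for \<epsilon> c d
  have \<eta>: "0 < \<eta> \<epsilon> d" if "0 < \<epsilon>" for \<epsilon> d
    unfolding \<eta>_def using odd_pos[OF n(1)] size_pos that by (rule decay_rate_pos)
  show ?thesis
  proof (rule exI[of _ \<gamma>], rule exI[of _ r], intro conjI allI impI)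
    fix \<epsilon> c d :: real assume "0 < \<epsilon> \<and> 0 < c"
    then show "0 < \<gamma> \<epsilon> c d" "0 < r \<epsilon> c d" using \<eta> by (simp_all add: \<gamma>_def r_def)
  next
    fix N :: "nat \<Rightarrow> 'a set" and Z :: "'a set" and c d :: real
    let ?N = "{N i \<inter> N j | i j. 2 \<le> i \<and> 2 \<le> j}"
    assume hyp: "(\<forall>j\<ge>2. N j \<lhd> G \<and> finite (carrier (G Mod N j))) \<and>
       Z \<subseteq> carrier G \<and>
       property_tau G ?N \<and>
       (\<forall>j\<ge>2. real (card (carrier (G Mod N j))) \<le> real j powr d) \<and>
       (\<forall>i\<ge>2. \<forall>j\<ge>2. i \<noteq> j \<longrightarrow>
          card (carrier (G Mod (N i \<inter> N j))) =
            card (carrier (G Mod N i)) * card (carrier (G Mod N j))) \<and>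
       0 < c \<and>
       (\<forall>j\<ge>2. real (card ((\<lambda>z. N j #>\<^bsub>G\<^esub> z) ` Z)) \<le>
          (1 - c) * real (card (carrier (G Mod N j))))"
    then have sieve: "sieve_conditions G N Z c d" and tau: "property_tau G ?N"
      unfolding sieve_conditions_def by blast+
    show "\<exists>\<epsilon>>0. cayley_expander_family G ?S ?N \<epsilon>"
      by (rule expander_family_transfer[OF assms(4) tau sieve_conditions_normal[OF sieve]])
    show "exponentially_small G Z"
      using assms(1) sieve tau by (rule exponentially_small_of_sieve)
    fix \<epsilon> :: real and k :: nat
    assume \<epsilon>: "0 < \<epsilon>" and fam: "cayley_expander_family G ?S ?N \<epsilon>" and k: "r \<epsilon> c d \<le> real k"
    have C: "0 < decay_factor c d" using sieve by (simp add: sieve_conditions_def decay_factor_pos)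
    have "ln (decay_factor c d) \<le> \<eta> \<epsilon> d / 2 * real k"
      using k \<eta>[OF \<epsilon>, of d] by (simp add: r_def field_simps)
    then have "decay_factor c d \<le> exp (\<eta> \<epsilon> d / 2 * real k)"
      using C by (metis exp_le_cancel_iff exp_ln)
    then have "decay_factor c d * exp (- \<eta> \<epsilon> d * real k) \<le>
        exp (\<eta> \<epsilon> d / 2 * real k) * exp (- \<eta> \<epsilon> d * real k)"
      by (rule mult_right_mono) simp
    also have "\<dots> = exp (- \<gamma> \<epsilon> c d * real k)"
      by (simp add: \<gamma>_def flip: exp_add)
    finally show "walk_prob G ?S k Z \<le> exp (- \<gamma> \<epsilon> c d * real k)"
      using walk_prob_exponential_decay[OF sieve \<epsilon> fam n(2,1), of k] by (simp add: \<eta>_def)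
  qed
qed

end
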